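(* Let $\{G_n\}_{n\in\mathbb N}$ be a sequence of (possibly random) graphs, $G_n$ having $n$ vertices, which is a large-set expander sequence with bounded average degree and which converges in probability in the local weak sense to $(G,o)\in\mathcal G_*$ with distribution $\mu$. Let $p\in[0,1]$ and assume $\mu$ is smooth at $p$. Let $\mathcal N=\mathcal N(G_n)$ be the final number of infected vertices in the SIR model with parameter $p$ on $G_n$ started from a single uniformly random vertex. Then: (1) if $\omega:\mathbb N\to\mathbb R$ satisfies $\omega(n)\to\infty$ and $\omega(n)/n\to 0$, then $\mathbb P\big(\omega(n)\le \mathcal N\le n/\omega(n)\big)\to 0$ as $n\to\infty$, where $\mathbb P$ is over the randomness of $G_n$, the seed and the infection process; (2) $\mathcal N/n$ converges in distribution to the two-atom random variable $\chi_p$ which equals $\zeta(p)$ with probability $\zeta(p)$ and $0$ with probability $1-\zeta(p)$; i.e. $\mathbb E[f(\mathcal N/n)]\to\mathbb E[f(\chi_p)]$ for every bounded continuous $f:[0,1]\to\mathbb R$.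
   Context: $\mathcal G_*$ is the space of isomorphism classes (root-preserving) of rooted, connected, locally finite graphs $(G,o)$. A function $f:\mathcal G_*\to\mathbb R$ is $k$-local if $f(G,o)$ depends only on the ball of radius $k$ around $o$. A sequence of (possibly random) finite graphs $\{G_n\}$ converges in probability in the local weak sense to a non-random probability measure $\mu$ on $\mathcal G_*$ if for every $k<\infty$ and every bounded $k$-local $f$, $\frac{1}{|V(G_n)|}\sum_{v\in V(G_n)} f(G_n,v)\to\int f\,d\mu$ in probability (where $(G_n,v)$ is the component of $v$ rooted at $v$). For a graph $G$ and $p\in[0,1]$, $G(p)$ is bond percolation: each edge is retained independently with probability $p$; $C(v)$ is the component of $v$ in $G(p)$. Define $\zeta(p)=\int \mathbb P_{G(p)}(|C(o)|=\infty)\,d\mu(G,o)$; $\mu$ is smooth at $p$ if $\zeta$ is continuous at $p$. For $G=(V,E)$ and $\epsilon<1/2$, $\phi(G,\epsilon)=\min_{A\subset V:\ \epsilon|V|\le|A|\le|V|/2} e(A,V\setminus A)/|A|$, where $e(A,V\setminus A)$ is the number of edges between $A$ and its complement. $G$ is an $(\alpha,\epsilon,\bar d)$ large-set expander if its average degree is at most $\bar d$ and $\phi(G,\epsilon)\ge\alpha$. $\{G_n\}$ is a large-set expander sequence with bounded average degree if there exist $\bar d<\infty$ and $\alpha>0$ such that for every $\epsilon\in(0,1/2)$, $\mathbb P(G_n\text{ is an }(\alpha,\epsilon,\bar d)\text{ large-set expander})\to1$. SIR model with fixed recovery time (independent cascade) with parameter $p$: starting from a set of initially infected vertices, each vertex,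 once infected, transmits the infection to each of its neighbours independently with probability $p$ (one independent trial per edge); the process ends when no new infections occur. *)

theory Defs
  imports "HOL-Probability.Probability"
begin

text \<open>Graphs are edge predicates on nat. A rooted graph in the limit space is
represented by an edge predicate on nat with root 0 (only the component of 0 matters).
A finite graph with n vertices is an edge predicate on the vertex set {0..<n}.\<close>

type_synonym graph = "nat \<Rightarrow> nat \<Rightarrow> bool"

definition graph_M :: "graph measure" where
  "graph_M = Pi\<^sub>M UNIV (\<lambda>_::nat. Pi\<^sub>M UNIV (\<lambda>_::nat. count_space (UNIV :: bool set)))"

definition simple_graph :: "graph \<Rightarrow> bool" where
  "simple_graph G \<longleftrightarrow> (\<forall>u v. G u v \<longrightarrow> G v u) \<and> (\<forall>u. \<not> G u u)"

definition locally_finite :: "graph \<Rightarrow> bool" where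
  "locally_finite G \<longleftrightarrow> (\<forall>v. finite {w. G v w})"

definition finite_graph_on :: "nat \<Rightarrow> graph \<Rightarrow> bool" where
  "finite_graph_on n G \<longleftrightarrow> simple_graph G \<and> (\<forall>u v. G u v \<longrightarrow> u < n \<and> v < n)"

definition ball0 :: "nat \<Rightarrow> graph \<Rightarrow> nat set" where
  "ball0 k G = {v. \<exists>j\<le>k. (G ^^ j) 0 v}"

definition balls_iso :: "nat \<Rightarrow> graph \<Rightarrow> graph \<Rightarrow> bool" where
  "balls_iso k G H \<longleftrightarrow> (\<exists>\<phi>. bij_betw \<phi> (ball0 k G) (ball0 k H) \<and> \<phi> 0 = 0 \<and>
      (\<forall>u\<in>ball0 k G. \<forall>w\<in>ball0 k G. G u w \<longleftrightarrow> H (\<phi> u) (\<phi> w)))"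

definition k_local :: "nat \<Rightarrow> (graph \<Rightarrow> real) \<Rightarrow> bool" where
  "k_local k f \<longleftrightarrow> (\<forall>G H. balls_iso k G H \<longrightarrow> f G = f H)"

definition swap0 :: "nat \<Rightarrow> nat \<Rightarrow> nat" where
  "swap0 v x = (if x = 0 then v else if x = v then 0 else x)"

definition reroot :: "graph \<Rightarrow> nat \<Rightarrow> graph" where
  "reroot G v = (\<lambda>a b. G (swap0 v a) (swap0 v b))"

definition local_weak_conv_prob :: "(nat \<Rightarrow> graph pmf) \<Rightarrow> graph measure \<Rightarrow> bool" where
  "local_weak_conv_prob Gs \<mu> \<longleftrightarrow>
     (\<forall>k. \<forall>f. f \<in> borel_measurable graph_M \<and> bounded (range f) \<and> k_local k f \<longrightarrow>
        (\<forall>\<epsilon>>0. (\<lambda>n. measure_pmf.prob (Gs n)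
            {G. \<bar>(\<Sum>v<n. f (reroot G v)) / real n - (\<integral>H. f H \<partial>\<mu>)\<bar> > \<epsilon>}) \<longlonglongrightarrow> 0))"

definition average_degree :: "nat \<Rightarrow> graph \<Rightarrow> real" where
  "average_degree n G = (\<Sum>v<n. real (card {w. w < n \<and> G v w})) / real n"

definition edges_between :: "graph \<Rightarrow> nat set \<Rightarrow> nat set \<Rightarrow> nat" where
  "edges_between G A B = card {(u, w). u \<in> A \<and> w \<in> B \<and> G u w}"

definition large_set_expander :: "real \<Rightarrow> real \<Rightarrow> real \<Rightarrow> nat \<Rightarrow> graph \<Rightarrow> bool" where
  "large_set_expander \<alpha> \<epsilon> d n G \<longleftrightarrow> average_degree n G \<le> d \<and>
     (\<forall>A. A \<subseteq> {0..<n} \<and> \<epsilon> * real n \<le> real (card A) \<and> real (card A) \<le> real n / 2 \<longrightarrow>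
        real (edges_between G A ({0..<n} - A)) \<ge> \<alpha> * real (card A))"

definition large_set_expander_seq :: "(nat \<Rightarrow> graph pmf) \<Rightarrow> bool" where
  "large_set_expander_seq Gs \<longleftrightarrow> (\<exists>d \<alpha>. \<alpha> > 0 \<and>
     (\<forall>\<epsilon>. 0 < \<epsilon> \<and> \<epsilon> < 1/2 \<longrightarrow>
        (\<lambda>n. measure_pmf.prob (Gs n) {G. large_set_expander \<alpha> \<epsilon> d n G}) \<longlonglongrightarrow> 1))"

text \<open>Bond percolation on a graph on nat: one Bernoulli(p) coin per unordered edge,
indexed by (min u v, max u v).\<close>
definition perc_M :: "real \<Rightarrow> (nat \<times> nat \<Rightarrow> bool) measure" where
  "perc_M p = Pi\<^sub>M UNIV (\<lambda>_::nat \<times> nat. measure_pmf (bernoulli_pmf p))"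

definition perc_graph :: "graph \<Rightarrow> (nat \<times> nat \<Rightarrow> bool) \<Rightarrow> graph" where
  "perc_graph G \<omega> = (\<lambda>u v. G u v \<and> \<omega> (min u v, max u v))"

definition cluster0 :: "graph \<Rightarrow> (nat \<times> nat \<Rightarrow> bool) \<Rightarrow> nat set" where
  "cluster0 G \<omega> = {v. (perc_graph G \<omega>)\<^sup>*\<^sup>* 0 v}"

definition zeta :: "graph measure \<Rightarrow> real \<Rightarrow> real" where
  "zeta \<mu> p = (\<integral>G. measure (perc_M p) {\<omega> \<in> space (perc_M p). infinite (cluster0 G \<omega>)} \<partial>\<mu>)"

text \<open>SIR model with fixed recovery time: state = (ever infected, currently infectious).
Each infectious vertex u tries to infect each neighbour w once, succeeding iff the
independent coin c (u, w) is True; infectious vertices recover after one step.\<close>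
primrec sir :: "graph \<Rightarrow> (nat \<times> nat \<Rightarrow> bool) \<Rightarrow> nat \<Rightarrow> nat \<Rightarrow> nat set \<times> nat set" where
  "sir G c s 0 = ({s}, {s})"
| "sir G c s (Suc t) = (let I = fst (sir G c s t); F = snd (sir G c s t);
      F' = {w. w \<notin> I \<and> (\<exists>u\<in>F. G u w \<and> c (u, w))} in (I \<union> F', F'))"

definition sir_final :: "graph \<Rightarrow> (nat \<times> nat \<Rightarrow> bool) \<Rightarrow> nat \<Rightarrow> nat set" where
  "sir_final G c s = (\<Union>t. fst (sir G c s t))"

definition sir_count :: "(nat \<Rightarrow> graph pmf) \<Rightarrow> real \<Rightarrow> nat \<Rightarrow> nat pmf" where
  "sir_count Gs p n = do {
     G \<leftarrow> Gs n;
     s \<leftarrow> pmf_of_set {0..<n};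
     c \<leftarrow> Pi_pmf ({0..<n} \<times> {0..<n}) False (\<lambda>_. bernoulli_pmf p);
     return_pmf (card (sir_final G c s)) }"

end

theory Submission
  imports Defs
begin

text \<open>
  The set finally infected from a seed has the law of the bond percolation cluster of the seed, so
  everything is about \<open>G\<^sub>n(p)\<close>. For fixed \<open>k\<close>, the fraction of vertices in clusters of size at
  least \<open>k\<close> is the average of a local function up to an error controlled by the Efron-Stein
  inequality, since one edge influences at most \<open>2k\<close> vertices; its limit \<open>\<zeta>\<^sub>k(p)\<close> decreases to
  \<open>\<zeta>(p)\<close> as \<open>k\<close> grows. Hence for large \<open>k\<close> about \<open>\<zeta>(p) n\<close> vertices lie in clusters of size at
  least \<open>k\<close>.

  It remains to see that almost all of them lie in a single cluster. By left continuity of \<open>\<zeta>\<close> at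
  \<open>p\<close>, some \<open>p' < p\<close> has almost as many vertices in clusters of size at least \<open>k\<close>. Pass from \<open>p'\<close>
  to \<open>p\<close> by sprinkling. There are at most \<open>2\<^bsup>n/k\<^esup>\<close> ways to split these clusters into two groups of
  linear size, and expansion provides linearly many edge-disjoint paths of bounded length between
  the two groups, so a given split survives the sprinkling with probability \<open>exp (-c n)\<close> where \<open>c\<close>
  does not depend on \<open>k\<close>. For large \<open>k\<close> the union bound rules out all splits.
\<close>

section \<open>Local functions: clusters of at least a given size\<close>

definition cluster :: "graph \<Rightarrow> nat \<Rightarrow> nat set" where
  "cluster R r = {v. R\<^sup>*\<^sup>* r v}"

definition cluster_ge :: "nat \<Rightarrow> graph \<Rightarrow> nat \<Rightarrow> bool" where
  "cluster_ge k R r \<longleftrightarrow> infinite (cluster R r) \<or> k \<le> card (cluster R r)"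

lemma infinite_or_card_ge_iff:
  "infinite A \<or> k \<le> card A \<longleftrightarrow> (\<exists>xs. distinct xs \<and> length xs = k \<and> set xs \<subseteq> A)"
proof
  assume "infinite A \<or> k \<le> card A"
  then obtain B where B: "finite B" "card B = k" "B \<subseteq> A"
    by (metis infinite_arbitrarily_large obtain_subset_with_card_n)
  then obtain xs where "set xs = B" "distinct xs" using finite_distinct_list by blast
  with B show "\<exists>xs. distinct xs \<and> length xs = k \<and> set xs \<subseteq> A"
    by (intro exI[of _ xs]) (auto simp: distinct_card)
next
  assume "\<exists>xs. distinct xs \<and> length xs = k \<and> set xs \<subseteq> A"
  then obtain xs where "distinct xs" "length xs = k" "set xs \<subseteq> A" by blast
  then show "infinite A \<or> k \<le> card A"
    using card_mono[of A "set xs"] distinct_card[of xs] by auto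
qed

definition gball :: "nat \<Rightarrow> graph \<Rightarrow> nat \<Rightarrow> nat set" where
  "gball k R r = {v. \<exists>j\<le>k. (R ^^ j) r v}"

lemma gball_subset_cluster: "gball k R r \<subseteq> cluster R r"
  by (auto simp: gball_def cluster_def dest: relpowp_imp_rtranclp)

lemma gball_Suc: "gball (Suc k) R r = gball k R r \<union> {w. \<exists>u\<in>gball k R r. R u w}"
proof -
  have "(\<exists>j\<le>Suc k. (R ^^ j) r w) \<longleftrightarrow> (\<exists>j\<le>k. (R ^^ j) r w) \<or> (\<exists>u. (\<exists>j\<le>k. (R ^^ j) r u) \<and> R u w)" for w
  proof
    assume "\<exists>j\<le>Suc k. (R ^^ j) r w"
    then obtain j where "j \<le> Suc k" "(R ^^ j) r w" by blast
    then show "(\<exists>j\<le>k. (R ^^ j) r w) \<or> (\<exists>u. (\<exists>j\<le>k. (R ^^ j) r u) \<and> R u w)"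
      by (cases j) (auto elim!: relpowp_Suc_E)
  next
    assume "(\<exists>j\<le>k. (R ^^ j) r w) \<or> (\<exists>u. (\<exists>j\<le>k. (R ^^ j) r u) \<and> R u w)"
    then show "\<exists>j\<le>Suc k. (R ^^ j) r w"
      by (meson Suc_le_mono le_SucI relpowp_Suc_I)
  qed
  then show ?thesis by (auto simp: gball_def)
qed

lemma gball_stable:
  assumes "gball (Suc k) R r = gball k R r"
  shows "cluster R r = gball k R r"
proof -
  have "R\<^sup>*\<^sup>* r v \<Longrightarrow> v \<in> gball k R r" for v
  proof (induction rule: rtranclp_induct)
    case base
    show ?case unfolding gball_def by (rule CollectI, rule exI[of _ 0]) simp
  next
    case (step y z)
    then show ?case using assms gball_Suc[of k R r] by blast
  qed
  then show ?thesis using gball_subset_cluster[of k R r] by (auto simp: cluster_def)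
qed

lemma card_gball_or_stable:
  "infinite (gball k R r) \<or> k < card (gball k R r) \<or> cluster R r = gball k R r"
proof (induction k)
  case 0
  have "gball 0 R r = {r}" by (auto simp: gball_def)
  then show ?case by simp
next
  case (Suc k)
  have sub: "gball k R r \<subseteq> gball (Suc k) R r" by (auto simp: gball_Suc)
  consider "infinite (gball k R r)" | "finite (gball k R r)" "k < card (gball k R r)"
    | "cluster R r = gball k R r" using Suc by blast
  then show ?case
  proof cases
    case 1
    then show ?thesis using sub finite_subset by blast
  next
    case 2
    show ?thesis
    proof (cases "gball (Suc k) R r = gball k R r")
      case True
      then show ?thesis using gball_stable by metis
    next
      case False
      then have "gball k R r \<subset> gball (Suc k) R r" using sub by blast
      then have "finite (gball (Suc k) R r) \<Longrightarrow> card (gball k R r) < card (gball (Suc k) R r)"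
        by (rule psubset_card_mono[rotated])
      then show ?thesis using 2 by linarith
    qed
  next
    case 3
    then show ?thesis using sub gball_subset_cluster[of "Suc k" R r] by blast
  qed
qed

lemma cluster_ge_ball:
  "cluster_ge k R r \<longleftrightarrow> (\<exists>xs. distinct xs \<and> length xs = k \<and> set xs \<subseteq> gball k R r)"
proof -
  have sub: "gball k R r \<subseteq> cluster R r" by (rule gball_subset_cluster)
  have "cluster_ge k R r \<longleftrightarrow> infinite (gball k R r) \<or> k \<le> card (gball k R r)"
  proof (cases "cluster R r = gball k R r")
    case True
    then show ?thesis by (simp add: cluster_ge_def)
  next
    case False
    then have "infinite (gball k R r) \<or> k < card (gball k R r)"
      using card_gball_or_stable[of k R r] by blast
    moreover have "infinite (cluster R r) \<or> card (gball k R r) \<le> card (cluster R r)"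
      using sub card_mono by blast
    moreover have "infinite (gball k R r) \<Longrightarrow> infinite (cluster R r)"
      using sub finite_subset by blast
    ultimately show ?thesis unfolding cluster_ge_def by linarith
  qed
  then show ?thesis using infinite_or_card_ge_iff by simp
qed

lemma infinite_cluster_iff: "infinite (cluster R r) \<longleftrightarrow> (\<forall>k. cluster_ge k R r)"
  unfolding cluster_ge_def using Suc_n_not_le_n by blast

lemma cluster0_eq_cluster: "cluster0 G \<omega> = cluster (perc_graph G \<omega>) 0"
  by (simp add: cluster0_def cluster_def)

lemma ball0_eq_ball: "ball0 k G = gball k G 0"
  by (simp add: ball0_def gball_def)

lemma gball_perc_graph_subset: "gball j (perc_graph G x) r \<subseteq> gball j G r"
proof -
  have "(perc_graph G x ^^ i) r v \<Longrightarrow> (G ^^ i) r v" for i v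
    by (induction i arbitrary: v) (auto simp: perc_graph_def)
  then show ?thesis by (auto simp: gball_def)
qed

text \<open>Coins outside \<^term>\<open>I\<close> have the constant value \<^term>\<open>undefined\<close> on the product space.\<close>

lemma measurable_coin:
  assumes "\<And>e. e \<in> I \<Longrightarrow> sets (M e) = sets (count_space UNIV)"
  shows "Measurable.pred (PiM I M) (\<lambda>x :: 'i \<Rightarrow> bool. x e)"
proof (cases "e \<in> I")
  case True
  then have "(\<lambda>x. x e) \<in> measurable (PiM I M) (M e)" by (rule measurable_component_singleton)
  then show ?thesis using assms[OF True] measurable_cong_sets by blast
next
  case False
  have "Measurable.pred (PiM I M) (\<lambda>x. undefined :: bool)" by simp
  moreover have "x e = undefined" if "x \<in> space (PiM I M)" for x
    using that False by (auto simp: space_PiM PiE_def extensional_def)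
  ultimately show ?thesis using measurable_cong[of "PiM I M" "\<lambda>x. x e" "\<lambda>_. undefined"] by auto
qed

lemma measurable_relpowp:
  fixes R :: "'x \<Rightarrow> graph"
  assumes [measurable]: "\<And>u v. Measurable.pred N (\<lambda>x. R x u v)"
  shows "Measurable.pred N (\<lambda>x. (R x ^^ j) r v)"
proof (induction j arbitrary: v)
  case 0
  have "(\<lambda>x. (R x ^^ 0) r v) = (\<lambda>_. r = v)" by auto
  then show ?case by simp
next
  case (Suc j)
  note Suc[measurable]
  have "(\<lambda>x. (R x ^^ Suc j) r v) = (\<lambda>x. \<exists>u. (R x ^^ j) r u \<and> R x u v)"
    by (auto simp: fun_eq_iff)
  then show ?case by simp
qed

lemma measurable_cluster_ge:
  assumes "\<And>u v. Measurable.pred N (\<lambda>x. R x u v)"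
  shows "Measurable.pred N (\<lambda>x. cluster_ge k (R x) r)"
proof -
  note measurable_relpowp[OF assms, measurable]
  have "(\<lambda>x. cluster_ge k (R x) r) = (\<lambda>x. \<exists>xs. distinct xs \<and> length xs = k \<and>
     (\<forall>v\<in>set xs. \<exists>j\<in>{..k}. (R x ^^ j) r v))"
    by (auto simp: fun_eq_iff cluster_ge_ball gball_def subset_iff Bex_def)
  then show ?thesis by simp
qed

lemma measurable_edge: "Measurable.pred graph_M (\<lambda>G. G u v)"
proof -
  have 1: "(\<lambda>G. G u) \<in> measurable graph_M (Pi\<^sub>M UNIV (\<lambda>_::nat. count_space (UNIV :: bool set)))"
    unfolding graph_M_def by (rule measurable_component_singleton) simp
  show ?thesis
    using measurable_compose[OF 1 measurable_coin[where I = UNIV and M = "\<lambda>_. count_space UNIV" and e = v]]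
    by simp
qed

lemma prob_space_perc_M: "prob_space (perc_M p)"
  unfolding perc_M_def by (intro prob_space_PiM measure_pmf.prob_space_axioms)

lemma space_perc_M [simp]: "space (perc_M p) = UNIV"
  by (auto simp: perc_M_def space_PiM)

lemma space_graph_M [simp]: "space graph_M = UNIV"
  by (auto simp: graph_M_def space_PiM PiE_UNIV_domain)

lemma measurable_perc_coin: "Measurable.pred (perc_M p) (\<lambda>\<omega>. \<omega> e)"
  unfolding perc_M_def by (rule measurable_coin) simp

definition size_prob :: "nat \<Rightarrow> real \<Rightarrow> graph \<Rightarrow> nat \<Rightarrow> real" where
  "size_prob k p G r = measure (perc_M p) {\<omega>. cluster_ge k (perc_graph G \<omega>) r}"

lemma sets_cluster_ge: "{\<omega>. cluster_ge k (perc_graph G \<omega>) r} \<in> sets (perc_M p)"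
proof -
  note measurable_perc_coin[measurable]
  have "Measurable.pred (perc_M p) (\<lambda>\<omega>. cluster_ge k (perc_graph G \<omega>) r)"
    by (rule measurable_cluster_ge) (simp add: perc_graph_def)
  then show ?thesis by (simp add: pred_def)
qed

lemma size_prob_bounds: "0 \<le> size_prob k p G r" "size_prob k p G r \<le> 1"
  by (auto simp: size_prob_def prob_space.prob_le_1[OF prob_space_perc_M])

lemma measurable_size_prob: "(\<lambda>G. size_prob k p G r) \<in> borel_measurable graph_M"
proof -
  interpret prob_space "perc_M p" by (rule prob_space_perc_M)
  have m [measurable]: "Measurable.pred (graph_M \<Otimes>\<^sub>M perc_M p) (\<lambda>x. fst x u v)" for u v
    by (rule measurable_compose[OF measurable_fst measurable_edge])
  have [measurable]: "Measurable.pred (graph_M \<Otimes>\<^sub>M perc_M p) (\<lambda>x. snd x e)" for e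
    by (rule measurable_compose[OF measurable_snd measurable_perc_coin])
  have "Measurable.pred (graph_M \<Otimes>\<^sub>M perc_M p) (\<lambda>x. cluster_ge k (perc_graph (fst x) (snd x)) r)"
    by (rule measurable_cluster_ge) (simp add: perc_graph_def)
  then have "{x. cluster_ge k (perc_graph (fst x) (snd x)) r} \<in> sets (graph_M \<Otimes>\<^sub>M perc_M p)"
    by (simp add: pred_def space_pair_measure)
  then have "(\<lambda>G. emeasure (perc_M p) (Pair G -` {x. cluster_ge k (perc_graph (fst x) (snd x)) r}))
      \<in> borel_measurable graph_M"
    by (rule measurable_emeasure_Pair)
  then show ?thesis
    unfolding size_prob_def measure_def by (simp add: vimage_def)
qed

text \<open>A rooted isomorphism of \<^term>\<open>k\<close>-balls induces an injection between the unordered pairs that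
  index the coins, and the law of i.i.d. coins is invariant under injective reindexing.\<close>

lemma size_prob_iso:
  assumes bij: "bij_betw \<phi> (gball k G r) (gball k H s)" and root: "\<phi> r = s"
    and edges: "\<And>u w. u \<in> gball k G r \<Longrightarrow> w \<in> gball k G r \<Longrightarrow> G u w \<longleftrightarrow> H (\<phi> u) (\<phi> w)"
  shows "size_prob k p G r = size_prob k p H s"
proof -
  let ?B = "gball k G r"
  define key where "key = (\<lambda>u w :: nat. (min u w, max u w))"
  define I where "I = (\<lambda>(u, w). key u w) ` (?B \<times> ?B)"
  define t where "t = (\<lambda>(a, b). key (\<phi> a) (\<phi> b))"
  have inj: "inj_on \<phi> ?B" using bij by (rule bij_betw_imp_inj_on)
  have key_eq: "key a b = key c d \<longleftrightarrow> a = c \<and> b = d \<or> a = d \<and> b = c" for a b c d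
    by (auto simp: key_def min_def max_def)
  have t_key: "t (key u w) = key (\<phi> u) (\<phi> w)" for u w
    by (auto simp: t_def key_def min_def max_def)
  have "inj_on t I"
  proof (rule inj_onI)
    fix x y assume "x \<in> I" "y \<in> I" and eq: "t x = t y"
    then obtain a b c d where *: "x = key a b" "y = key c d" "a \<in> ?B" "b \<in> ?B" "c \<in> ?B" "d \<in> ?B"
      by (auto simp: I_def)
    then show "x = y"
      using eq inj by (auto simp: t_key key_eq inj_on_eq_iff)
  qed
  let ?P = "PiM I (\<lambda>_. measure_pmf (bernoulli_pmf p))"
  let ?Q = "\<lambda>x. cluster_ge k (perc_graph G x) r"
  have reindex: "size_prob k p G' r' = measure ?P {x \<in> space ?P. ?Q x}"
    if f: "inj_on f I" and eq: "\<And>\<omega>. cluster_ge k (perc_graph G' \<omega>) r' \<longleftrightarrow> ?Q (\<lambda>i\<in>I. \<omega> (f i))"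
    for f :: "nat \<times> nat \<Rightarrow> nat \<times> nat" and G' r'
  proof -
    have d: "distr (perc_M p) ?P (\<lambda>\<omega>. \<lambda>i\<in>I. \<omega> (f i)) = ?P"
      unfolding perc_M_def using f by (intro distr_PiM_reindex) (auto intro: measure_pmf.prob_space_axioms)
    have m: "(\<lambda>\<omega>. \<lambda>i\<in>I. \<omega> (f i)) \<in> measurable (perc_M p) ?P"
      unfolding perc_M_def by (intro measurable_restrict measurable_component_singleton) auto
    have [measurable]: "Measurable.pred ?P (\<lambda>x. x e)" for e
      by (rule measurable_coin) simp
    have "Measurable.pred ?P ?Q"
      by (rule measurable_cluster_ge) (simp add: perc_graph_def)
    then have s: "{x \<in> space ?P. ?Q x} \<in> sets ?P" by (simp add: pred_def)
    have "measure ?P {x \<in> space ?P. ?Q x} =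
        measure (perc_M p) ((\<lambda>\<omega>. \<lambda>i\<in>I. \<omega> (f i)) -` {x \<in> space ?P. ?Q x} \<inter> space (perc_M p))"
      using measure_distr[OF m s] d by simp
    also have "(\<lambda>\<omega>. \<lambda>i\<in>I. \<omega> (f i)) -` {x \<in> space ?P. ?Q x} \<inter> space (perc_M p)
        = {\<omega>. cluster_ge k (perc_graph G' \<omega>) r'}"
      using eq by (auto simp: space_PiM)
    finally show ?thesis by (simp add: size_prob_def)
  qed
  have image: "\<phi> ` gball j (perc_graph G (\<lambda>i\<in>I. \<omega> (t i))) r = gball j (perc_graph H \<omega>) s"
    (is "\<phi> ` gball j ?G r = gball j ?H s") if "j \<le> k" for \<omega> j
    using that
  proof (induction j)
    case 0
    then show ?case by (simp add: gball_def root)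
  next
    case (Suc j)
    have IH: "\<phi> ` gball j ?G r = gball j ?H s"
      using Suc.IH Suc.prems Suc_leD by blast
    have mono: "gball i R a \<subseteq> gball k R a" if "i \<le> k" for i R a
      using that by (auto simp: gball_def intro: order_trans)
    have G_B: "gball i ?G r \<subseteq> ?B" if "i \<le> k" for i
      using that mono gball_perc_graph_subset by blast
    have H_B: "gball i ?H s \<subseteq> \<phi> ` ?B" if "i \<le> k" for i
      using that mono[of i] gball_perc_graph_subset[of k H \<omega> s] bij_betw_imp_surj_on[OF bij] by blast
    have step: "?G u w \<longleftrightarrow> ?H (\<phi> u) (\<phi> w)" if "u \<in> ?B" "w \<in> ?B" for u w
    proof -
      have "key u w \<in> I" using that by (auto simp: I_def)
      then show ?thesis using that edges t_key[of u w] by (auto simp: perc_graph_def key_def)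
    qed
    show ?case
    proof (intro equalityI subsetI)
      fix y assume "y \<in> \<phi> ` gball (Suc j) ?G r"
      then obtain w where w: "w \<in> gball (Suc j) ?G r" "y = \<phi> w" by blast
      then consider "w \<in> gball j ?G r" | u where "u \<in> gball j ?G r" "?G u w" by (auto simp: gball_Suc)
      then show "y \<in> gball (Suc j) ?H s"
      proof cases
        case 1
        then show ?thesis using IH w by (auto simp: gball_Suc)
      next
        case 2
        then have "?H (\<phi> u) (\<phi> w)" using step G_B[of j] G_B[of "Suc j"] w Suc.prems by auto
        then show ?thesis using 2 IH w by (auto simp: gball_Suc)
      qed
    next
      fix y assume y: "y \<in> gball (Suc j) ?H s"
      then obtain w where w: "w \<in> ?B" "y = \<phi> w" using H_B[of "Suc j"] Suc.prems by blast
      consider "y \<in> gball j ?H s" | x where "x \<in> gball j ?H s" "?H x y" using y by (auto simp: gball_Suc)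
      then show "y \<in> \<phi> ` gball (Suc j) ?G r"
      proof cases
        case 1
        then show ?thesis using IH by (auto simp: gball_Suc)
      next
        case 2
        then obtain u where u: "u \<in> gball j ?G r" "x = \<phi> u" using IH by blast
        then have "?G u w" using step[of u w] 2 w G_B[of j] Suc.prems by auto
        then show ?thesis using u w by (auto simp: gball_Suc)
      qed
    qed
  qed
  have ball_card: "cluster_ge k R a \<longleftrightarrow> infinite (gball k R a) \<or> k \<le> card (gball k R a)" for R a
    by (simp only: cluster_ge_ball infinite_or_card_ge_iff)
  have "cluster_ge k (perc_graph H \<omega>) s \<longleftrightarrow> ?Q (\<lambda>i\<in>I. \<omega> (t i))" for \<omega>
  proof -
    have "inj_on \<phi> (gball k (perc_graph G (\<lambda>i\<in>I. \<omega> (t i))) r)"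
      using inj gball_perc_graph_subset by (rule inj_on_subset)
    then show ?thesis
      unfolding ball_card image[of k \<omega>, OF order_refl, symmetric]
      by (simp add: card_image finite_image_iff)
  qed
  then have 1: "size_prob k p H s = measure ?P {x \<in> space ?P. ?Q x}"
    using reindex[OF \<open>inj_on t I\<close>] by blast
  have "gball j (perc_graph G \<omega>) r = gball j (perc_graph G (\<lambda>i\<in>I. \<omega> i)) r" if "j \<le> k" for \<omega> j
    using that
  proof (induction j)
    case 0
    then show ?case by (simp add: gball_def)
  next
    case (Suc j)
    have sub: "gball (Suc j) R a \<subseteq> gball k R a" for R a
      using Suc.prems by (auto simp: gball_def intro: order_trans)
    have "perc_graph G \<omega> u w \<longleftrightarrow> perc_graph G (\<lambda>i\<in>I. \<omega> i) u w" if "u \<in> gball j (perc_graph G \<omega>) r" for u w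
    proof (cases "G u w")
      case True
      then have "u \<in> gball (Suc j) G r" "w \<in> gball (Suc j) G r"
        using that gball_perc_graph_subset[of j G \<omega> r] by (auto simp: gball_Suc)
      then have "u \<in> ?B" "w \<in> ?B" using sub by auto
      then have "key u w \<in> I" by (auto simp: I_def)
      then show ?thesis by (simp add: perc_graph_def key_def)
    qed (simp add: perc_graph_def)
    moreover have "gball j (perc_graph G \<omega>) r = gball j (perc_graph G (\<lambda>i\<in>I. \<omega> i)) r"
      using Suc.IH Suc.prems Suc_leD by blast
    ultimately show ?case unfolding gball_Suc by blast
  qed
  note ball_eq = this[OF order_refl]
  have "cluster_ge k (perc_graph G \<omega>) r \<longleftrightarrow> ?Q (\<lambda>i\<in>I. \<omega> i)" for \<omega>
    unfolding ball_card by (rule arg_cong[OF ball_eq, of "\<lambda>B. infinite B \<or> k \<le> card B"])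
  then have 2: "size_prob k p G r = measure ?P {x \<in> space ?P. ?Q x}"
    by (rule reindex[of "\<lambda>i. i", OF inj_on_id2])
  show ?thesis using 1 2 by simp
qed

lemma k_local_size_prob: "k_local k (\<lambda>G. size_prob k p G 0)"
  unfolding k_local_def balls_iso_def ball0_eq_ball using size_prob_iso by blast

lemma size_prob_reroot: "size_prob k p (reroot G v) 0 = size_prob k p G v"
proof (rule size_prob_iso)
  have swap: "swap0 v (swap0 v x) = x" for x by (auto simp: swap0_def)
  have 1: "(reroot G v ^^ j) 0 w \<longleftrightarrow> (G ^^ j) v (swap0 v w)" for j w
  proof (induction j arbitrary: w)
    case 0
    show ?case by (auto simp: swap0_def)
  next
    case (Suc j)
    have "(reroot G v ^^ Suc j) 0 w \<longleftrightarrow> (\<exists>u. (G ^^ j) v (swap0 v u) \<and> G (swap0 v u) (swap0 v w))"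
      using Suc by (auto simp: reroot_def relcompp_apply)
    also have "\<dots> \<longleftrightarrow> (\<exists>u. (G ^^ j) v u \<and> G u (swap0 v w))" using swap by metis
    finally show ?case by (simp add: relcompp_apply)
  qed
  show "bij_betw (swap0 v) (gball k (reroot G v) 0) (gball k G v)"
    by (rule bij_betwI[where g = "swap0 v"]) (auto simp: gball_def 1 swap)
  show "swap0 v 0 = v" by (simp add: swap0_def)
qed (simp add: reroot_def)

definition zeta_ge :: "graph measure \<Rightarrow> nat \<Rightarrow> real \<Rightarrow> real" where
  "zeta_ge \<mu> k p = (\<integral>G. size_prob k p G 0 \<partial>\<mu>)"

lemma conv_size_prob:
  assumes "local_weak_conv_prob Gs \<mu>" "\<epsilon> > 0"
  shows "(\<lambda>n. measure_pmf.prob (Gs n)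
            {G. \<bar>(\<Sum>v<n. size_prob k p G v) / real n - zeta_ge \<mu> k p\<bar> > \<epsilon>}) \<longlonglongrightarrow> 0"
proof -
  have "bounded (range (\<lambda>G. size_prob k p G 0))"
    using size_prob_bounds by (intro boundedI[of _ 1]) auto
  then have "(\<lambda>n. measure_pmf.prob (Gs n) {G. \<bar>(\<Sum>v<n. size_prob k p (reroot G v) 0) / real n
      - (\<integral>H. size_prob k p H 0 \<partial>\<mu>)\<bar> > \<epsilon>}) \<longlonglongrightarrow> 0"
    using assms measurable_size_prob k_local_size_prob unfolding local_weak_conv_prob_def by blast
  then show ?thesis by (simp add: size_prob_reroot zeta_ge_def)
qed

lemma cluster_ge_antimono: "k \<le> l \<Longrightarrow> cluster_ge l R r \<Longrightarrow> cluster_ge k R r"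
  by (auto simp: cluster_ge_def)

context
  fixes \<mu> :: "graph measure"
  assumes mu_prob: "prob_space \<mu>" and mu_sets: "sets \<mu> = sets graph_M"
begin

lemma zeta_ge_tendsto_zeta: "(\<lambda>k. zeta_ge \<mu> k p) \<longlonglongrightarrow> zeta \<mu> p"
  and zeta_le_zeta_ge: "zeta \<mu> p \<le> zeta_ge \<mu> k p"
  and zeta_bounds: "0 \<le> zeta \<mu> p" "zeta \<mu> p \<le> 1"
proof -
  interpret prob_space \<mu> by (rule mu_prob)
  interpret P: prob_space "perc_M p" by (rule prob_space_perc_M)
  define h where "h = (\<lambda>G. measure (perc_M p) {\<omega> \<in> space (perc_M p). infinite (cluster0 G \<omega>)})"
  have h: "h G = measure (perc_M p) (\<Inter>k. {\<omega>. cluster_ge k (perc_graph G \<omega>) 0})" for G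
  proof -
    have "{\<omega> \<in> space (perc_M p). infinite (cluster0 G \<omega>)} = (\<Inter>k. {\<omega>. cluster_ge k (perc_graph G \<omega>) 0})"
      unfolding cluster0_eq_cluster infinite_cluster_iff by auto
    then show ?thesis by (simp only: h_def)
  qed
  have lim: "(\<lambda>k. size_prob k p G 0) \<longlonglongrightarrow> h G" for G
    unfolding h size_prob_def
    by (intro P.finite_Lim_measure_decseq) (auto simp: sets_cluster_ge decseq_def intro: cluster_ge_antimono)
  have le: "h G \<le> size_prob k p G 0" for G k
    unfolding h size_prob_def by (intro P.finite_measure_mono) (auto simp: sets_cluster_ge)
  have m [measurable]: "(\<lambda>G. size_prob k p G 0) \<in> borel_measurable \<mu>" for k
    using measurable_size_prob mu_sets measurable_cong_sets by blast
  have [measurable]: "h \<in> borel_measurable \<mu>"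
    by (rule borel_measurable_LIMSEQ_real[OF lim m])
  have int: "integrable \<mu> (\<lambda>G. size_prob k p G 0)" for k
    using size_prob_bounds by (intro integrable_const_bound[where B = 1]) auto
  have hb: "0 \<le> h G" "h G \<le> 1" for G by (auto simp: h_def P.prob_le_1)
  have inth: "integrable \<mu> h"
    using hb by (intro integrable_const_bound[where B = 1]) auto
  have z: "zeta \<mu> p = (\<integral>G. h G \<partial>\<mu>)" by (simp add: zeta_def h_def)
  show "(\<lambda>k. zeta_ge \<mu> k p) \<longlonglongrightarrow> zeta \<mu> p"
    unfolding zeta_ge_def z
    by (rule integral_dominated_convergence[where w = "\<lambda>_. 1"])
       (use lim size_prob_bounds in auto)
  show "zeta \<mu> p \<le> zeta_ge \<mu> k p"
    unfolding zeta_ge_def z using int inth le by (intro integral_mono) auto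
  show "0 \<le> zeta \<mu> p" unfolding z using hb by (intro Bochner_Integration.integral_nonneg) auto
  have "(\<integral>G. h G \<partial>\<mu>) \<le> (\<integral>G. 1 \<partial>\<mu>)" using hb inth by (intro integral_mono) auto
  then show "zeta \<mu> p \<le> 1" unfolding z by (simp add: prob_space)
qed

lemma zeta_0: "zeta \<mu> 0 = 0"
proof -
  interpret P: prob_space "perc_M 0" by (rule prob_space_perc_M)
  have "size_prob 2 0 G 0 = 0" for G
  proof -
    have ae: "AE \<omega> in perc_M 0. \<forall>e. \<not> \<omega> e"
    proof (subst AE_all_countable, rule allI)
      fix e
      have "AE x in bernoulli_pmf 0. \<not> x"
        by (simp add: AE_measure_pmf_iff set_pmf_iff Ball_def all_bool_eq)
      then show "AE \<omega> in perc_M 0. \<not> \<omega> e" unfolding perc_M_def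
        by (intro AE_PiM_component) (auto intro: measure_pmf.prob_space_axioms)
    qed
    have small: "\<not> cluster_ge 2 (perc_graph G \<omega>) 0" if "\<forall>e. \<not> \<omega> e" for \<omega>
    proof -
      have "perc_graph G \<omega> = (\<lambda>_ _. False)" using that by (auto simp: perc_graph_def)
      then have "cluster (perc_graph G \<omega>) 0 = {0}"
        by (auto simp: cluster_def elim: rtranclp.cases)
      then show ?thesis by (simp add: cluster_ge_def)
    qed
    from ae have "AE \<omega> in perc_M 0. \<omega> \<notin> {\<omega>. cluster_ge 2 (perc_graph G \<omega>) 0}"
      by (rule eventually_mono) (use small in blast)
    then show ?thesis unfolding size_prob_def
      by (subst P.prob_eq_0[OF sets_cluster_ge])
  qed
  then have "zeta_ge \<mu> 2 0 = 0" by (simp add: zeta_ge_def)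
  then show ?thesis using zeta_le_zeta_ge[of 0 2] zeta_bounds[of 0] by simp
qed

end

section \<open>Concentration of the number of vertices in big clusters\<close>

definition coins :: "nat \<Rightarrow> real \<Rightarrow> (nat \<times> nat \<Rightarrow> bool) pmf" where
  "coins n p = Pi_pmf ({0..<n} \<times> {0..<n}) False (\<lambda>_. bernoulli_pmf p)"

lemma perc_M_eq_Pi_pmf:
  assumes A: "finite A" and dep: "\<And>\<omega>. Q \<omega> \<longleftrightarrow> Q (\<lambda>e. e \<in> A \<and> \<omega> e)"
  shows "measure (perc_M p) {\<omega>. Q \<omega>} = measure_pmf.prob (Pi_pmf A False (\<lambda>_. bernoulli_pmf p)) {c. Q c}"
proof -
  interpret P: product_prob_space "\<lambda>_. measure_pmf (bernoulli_pmf p)" "UNIV :: (nat \<times> nat) set"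
    by unfold_locales
  let ?M = "Pi_pmf A False (\<lambda>_. bernoulli_pmf p)"
  define S where "S = {f. (\<forall>e. e \<notin> A \<longrightarrow> \<not> f e) \<and> Q f}"
  have "S \<subseteq> PiE_dflt A False (\<lambda>_. UNIV)" by (auto simp: S_def PiE_dflt_def)
  moreover have "finite (PiE_dflt A False (\<lambda>_. UNIV :: bool set))" using A by (intro finite_PiE_dflt) auto
  ultimately have finS: "finite S" by (rule finite_subset)
  define cyl where "cyl f = {\<omega>. \<forall>e\<in>A. \<omega> e = f e}" for f :: "nat \<times> nat \<Rightarrow> bool"
  have cyl_eq: "cyl f = {x \<in> space (PiM UNIV (\<lambda>_. measure_pmf (bernoulli_pmf p))). \<forall>i\<in>A. x i \<in> {f i}}" for f
    by (auto simp: cyl_def space_PiM)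
  have sets: "cyl f \<in> sets (perc_M p)" for f
  proof -
    note measurable_perc_coin[measurable]
    have "Measurable.pred (perc_M p) (\<lambda>\<omega>. \<forall>e. e \<in> A \<longrightarrow> \<omega> e = f e)" by measurable
    then show ?thesis by (simp add: pred_def cyl_def Ball_def)
  qed
  have meas: "measure (perc_M p) (cyl f) = (\<Prod>e\<in>A. pmf (bernoulli_pmf p) (f e))" for f
    using P.emeasure_PiM_Collect[of A "\<lambda>i. {f i}"] A
    unfolding perc_M_def cyl_eq measure_def
    by (simp add: emeasure_pmf_single prod_ennreal prod_nonneg)
  have union: "{\<omega>. Q \<omega>} = (\<Union>f\<in>S. cyl f)"
  proof (intro equalityI subsetI)
    fix \<omega> assume "\<omega> \<in> {\<omega>. Q \<omega>}"
    then have "(\<lambda>e. e \<in> A \<and> \<omega> e) \<in> S" using dep[of \<omega>] by (auto simp: S_def)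
    then show "\<omega> \<in> (\<Union>f\<in>S. cyl f)" by (rule UN_I) (auto simp: cyl_def)
  next
    fix \<omega> assume "\<omega> \<in> (\<Union>f\<in>S. cyl f)"
    then obtain f where f: "f \<in> S" "\<omega> \<in> cyl f" by blast
    then have "(\<lambda>e. e \<in> A \<and> \<omega> e) = f" by (auto simp: S_def cyl_def fun_eq_iff)
    then show "\<omega> \<in> {\<omega>. Q \<omega>}" using f dep[of \<omega>] by (auto simp: S_def)
  qed
  have disj: "disjoint_family_on cyl S"
  proof (unfold disjoint_family_on_def, intro ballI impI)
    fix f g assume "f \<in> S" "g \<in> S" "f \<noteq> g"
    then obtain e where "f e \<noteq> g e" by (auto simp: fun_eq_iff)
    moreover from this have "e \<in> A" using \<open>f \<in> S\<close> \<open>g \<in> S\<close> unfolding S_def by blast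
    ultimately have "\<exists>e\<in>A. f e \<noteq> g e" by blast
    then show "cyl f \<inter> cyl g = {}" by (auto simp: cyl_def)
  qed
  interpret PM: prob_space "perc_M p" by (rule prob_space_perc_M)
  have "measure (perc_M p) {\<omega>. Q \<omega>} = (\<Sum>f\<in>S. measure (perc_M p) (cyl f))"
    unfolding union using finS disj sets by (intro PM.finite_measure_finite_Union) auto
  also have "\<dots> = (\<Sum>f\<in>S. pmf ?M f)"
    unfolding meas using A by (intro sum.cong refl pmf_Pi'[symmetric]) (auto simp: S_def)
  also have "\<dots> = measure_pmf.prob ?M S" using finS by (simp add: measure_measure_pmf_finite)
  also have "\<dots> = measure_pmf.prob ?M {c. Q c}"
    using A by (intro measure_prob_cong_0) (auto simp: S_def intro!: pmf_Pi_outside)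
  finally show ?thesis .
qed

lemma size_prob_eq_coins:
  assumes "finite_graph_on n G"
  shows "size_prob k p G v = measure_pmf.prob (coins n p) {c. cluster_ge k (perc_graph G c) v}"
  unfolding size_prob_def coins_def
proof (rule perc_M_eq_Pi_pmf)
  fix \<omega>
  have "perc_graph G \<omega> = perc_graph G (\<lambda>e. e \<in> {0..<n} \<times> {0..<n} \<and> \<omega> e)"
    using assms by (fastforce simp: perc_graph_def finite_graph_on_def fun_eq_iff min_def max_def)
  then show "cluster_ge k (perc_graph G \<omega>) v \<longleftrightarrow>
      cluster_ge k (perc_graph G (\<lambda>e. e \<in> {0..<n} \<times> {0..<n} \<and> \<omega> e)) v"
    by simp
qed simp

lemma finite_set_Pi_pmf_bool:
  assumes "finite A"
  shows "finite (set_pmf (Pi_pmf A d (q :: 'a \<Rightarrow> bool pmf)))"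
  unfolding set_Pi_pmf[OF assms] using assms by (intro finite_PiE_dflt) auto

lemma variance_le_sum_influences:
  fixes f :: "('a \<Rightarrow> bool) \<Rightarrow> real" and b :: "'a \<Rightarrow> real"
  assumes "finite A" and p: "0 \<le> p" "p \<le> 1"
    and "\<And>i c. i \<in> A \<Longrightarrow> \<bar>f (c(i := True)) - f (c(i := False))\<bar> \<le> b i"
  defines "M \<equiv> Pi_pmf A False (\<lambda>_. bernoulli_pmf p)"
  shows "measure_pmf.variance M f \<le> (\<Sum>i\<in>A. (b i)\<^sup>2)"
  using assms(1,4) unfolding M_def
proof (induction A arbitrary: f)
  case empty
  show ?case by simp
next
  case (insert i A)
  let ?P = "Pi_pmf A False (\<lambda>_. bernoulli_pmf p)"
  let ?P' = "Pi_pmf (insert i A) False (\<lambda>_. bernoulli_pmf p)"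
  have fin: "finite (set_pmf ?P)" by (rule finite_set_Pi_pmf_bool[OF insert(1)])
  have int: "integrable (measure_pmf ?P) f" for f :: "_ \<Rightarrow> real"
    by (rule integrable_measure_pmf_finite[OF fin])
  have split: "measure_pmf.expectation ?P' h =
      p * measure_pmf.expectation ?P (\<lambda>g. h (g(i := True)))
      + (1 - p) * measure_pmf.expectation ?P (\<lambda>g. h (g(i := False)))" for h :: "_ \<Rightarrow> real"
  proof -
    have "?P' = bind_pmf (bernoulli_pmf p) (\<lambda>y. map_pmf (\<lambda>g. g(i := y)) ?P)"
      using insert(1,2) by (subst Pi_pmf_insert') (auto simp: map_pmf_def)
    then have "measure_pmf.expectation ?P' h =
        measure_pmf.expectation (bernoulli_pmf p) (\<lambda>y. measure_pmf.expectation (map_pmf (\<lambda>g. g(i := y)) ?P) h)"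
      using fin by (simp only:, subst pmf_expectation_bind[of UNIV]) (auto simp: integral_measure_pmf[of UNIV])
    then show ?thesis using p by simp
  qed
  define f1 where "f1 = (\<lambda>g. f (g(i := True)))"
  define f0 where "f0 = (\<lambda>g. f (g(i := False)))"
  define m1 where "m1 = measure_pmf.expectation ?P f1"
  define m0 where "m0 = measure_pmf.expectation ?P f0"
  define m where "m = p * m1 + (1 - p) * m0"
  have Ef: "measure_pmf.expectation ?P' f = m"
    unfolding split m_def m1_def m0_def f1_def f0_def by simp
  have shift: "measure_pmf.expectation ?P (\<lambda>g. (h g - m)\<^sup>2)
      = measure_pmf.variance ?P h + (measure_pmf.expectation ?P h - m)\<^sup>2" for h :: "_ \<Rightarrow> real"
  proof -
    define e where "e = measure_pmf.expectation ?P h"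
    have "measure_pmf.expectation ?P (\<lambda>g. (h g - m)\<^sup>2)
        = measure_pmf.expectation ?P (\<lambda>g. (h g - e)\<^sup>2 + 2 * (e - m) * (h g - e) + (e - m)\<^sup>2)"
      by (intro Bochner_Integration.integral_cong) (auto simp: power2_eq_square algebra_simps)
    also have "\<dots> = measure_pmf.expectation ?P (\<lambda>g. (h g - e)\<^sup>2)
        + 2 * (e - m) * (measure_pmf.expectation ?P h - e) + (e - m)\<^sup>2"
      using int by simp
    finally show ?thesis by (simp add: e_def)
  qed
  have "measure_pmf.variance ?P h \<le> (\<Sum>i\<in>A. (b i)\<^sup>2)" if h: "h = f1 \<or> h = f0" for h
  proof (rule insert.IH)
    fix j and c :: "'a \<Rightarrow> bool" assume j: "j \<in> A"
    then have "j \<noteq> i" using insert by auto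
    then have "(c(j := x))(i := y) = (c(i := y))(j := x)" for x y by (rule fun_upd_twist)
    moreover have "\<bar>f (c(i := y, j := True)) - f (c(i := y, j := False))\<bar> \<le> b j" for y
      by (rule insert.prems) (use j in simp)
    ultimately show "\<bar>h (c(j := True)) - h (c(j := False))\<bar> \<le> b j"
      using h by (auto simp only: f1_def f0_def)
  qed
  then have V: "measure_pmf.variance ?P f1 \<le> (\<Sum>i\<in>A. (b i)\<^sup>2)" "measure_pmf.variance ?P f0 \<le> (\<Sum>i\<in>A. (b i)\<^sup>2)"
    by auto
  have "\<bar>m1 - m0\<bar> \<le> b i"
  proof -
    have "m1 - m0 = measure_pmf.expectation ?P (\<lambda>g. f1 g - f0 g)"
      unfolding m1_def m0_def using int by simp
    also have "\<bar>\<dots>\<bar> \<le> measure_pmf.expectation ?P (\<lambda>g. \<bar>f1 g - f0 g\<bar>)" by (rule integral_abs_bound)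
    also have "\<dots> \<le> measure_pmf.expectation ?P (\<lambda>g. b i)"
      unfolding f1_def f0_def using int by (intro integral_mono insert.prems) auto
    finally show ?thesis by simp
  qed
  then have "(m1 - m0)\<^sup>2 \<le> (b i)\<^sup>2" by (metis abs_ge_zero order.trans power2_abs power_mono)
  moreover have "p * (1 - p) \<le> 1" using p by (intro mult_le_one) auto
  ultimately have mm: "p * (1 - p) * (m1 - m0)\<^sup>2 \<le> (b i)\<^sup>2"
    using mult_mono[of "p * (1 - p)" 1 "(m1 - m0)\<^sup>2" "(b i)\<^sup>2"] by simp
  have "measure_pmf.variance ?P' f = p * measure_pmf.expectation ?P (\<lambda>g. (f1 g - m)\<^sup>2)
      + (1 - p) * measure_pmf.expectation ?P (\<lambda>g. (f0 g - m)\<^sup>2)"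
    unfolding Ef by (subst split) (simp add: f1_def f0_def)
  also have "\<dots> = p * measure_pmf.variance ?P f1 + (1 - p) * measure_pmf.variance ?P f0
      + p * (1 - p) * (m1 - m0)\<^sup>2"
    unfolding shift by (fold m1_def m0_def) (simp add: m_def power2_eq_square algebra_simps)
  also have "\<dots> \<le> p * (\<Sum>i\<in>A. (b i)\<^sup>2) + (1 - p) * (\<Sum>i\<in>A. (b i)\<^sup>2) + (b i)\<^sup>2"
    using V mm p by (intro add_mono mult_left_mono) auto
  also have "\<dots> = (\<Sum>i\<in>insert i A. (b i)\<^sup>2)" using insert(1,2) by (simp add: algebra_simps)
  finally show ?case .
qed

lemma cluster_add_edge_irrelevant:
  assumes sub: "\<And>x y. R x y \<Longrightarrow> R' x y"
    and new: "\<And>x y. x \<in> cluster R s \<Longrightarrow> R' x y \<Longrightarrow> R x y \<or> y \<in> cluster R s"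
  shows "cluster R' s = cluster R s"
proof -
  have "R'\<^sup>*\<^sup>* s y \<Longrightarrow> R\<^sup>*\<^sup>* s y" for y
  proof (induction rule: rtranclp_induct)
    case (step y z)
    then show ?case using new[of y z] by (auto simp: cluster_def)
  qed simp
  moreover have "R\<^sup>*\<^sup>* s y \<Longrightarrow> R'\<^sup>*\<^sup>* s y" for y
    using rtranclp_mono[of R R'] sub by blast
  ultimately show ?thesis by (auto simp: cluster_def)
qed

lemma cluster_sym:
  assumes "symp R" "u \<in> cluster R v"
  shows "v \<in> cluster R u"
  using assms symp_rtranclp[of R] by (auto simp: cluster_def dest: sympD)

lemma cluster_eq:
  assumes "symp R" "u \<in> cluster R v"
  shows "cluster R u = cluster R v"
  using cluster_sym[OF assms] assms(2) by (auto simp: cluster_def intro: rtranclp_trans)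

lemma cluster_self [simp]: "v \<in> cluster R v"
  by (simp add: cluster_def)

lemma cluster_subset:
  assumes "\<And>x y. R x y \<Longrightarrow> y < n" "v < n"
  shows "cluster R v \<subseteq> {0..<n}"
proof -
  have "R\<^sup>*\<^sup>* v y \<Longrightarrow> y < n" for y
    by (induction rule: rtranclp_induct) (use assms in auto)
  then show ?thesis by (auto simp: cluster_def)
qed

definition big_vertices :: "nat \<Rightarrow> nat \<Rightarrow> graph \<Rightarrow> nat set" where
  "big_vertices n k R = {v. v < n \<and> cluster_ge k R v}"

lemma finite_big_vertices [simp]: "finite (big_vertices n k R)"
  by (simp add: big_vertices_def)

lemma cluster_mono:
  assumes "\<And>x y. R x y \<Longrightarrow> R' x y"
  shows "cluster R v \<subseteq> cluster R' v"
  using rtranclp_mono[of R R'] assms by (auto simp: cluster_def)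

lemma cluster_ge_mono:
  assumes "\<And>x y. R x y \<Longrightarrow> R' x y" "cluster_ge k R v"
  shows "cluster_ge k R' v"
  using assms(2) cluster_mono[of R R' v] assms(1) unfolding cluster_ge_def
  by (meson card_mono finite_subset order_trans)

lemma big_vertices_influence:
  assumes sym: "symp R" and sub: "\<And>x y. R x y \<Longrightarrow> R' x y"
    and new: "\<And>x y. R' x y \<Longrightarrow> R x y \<or> x = a \<and> y = b \<or> x = b \<and> y = a"
  shows "\<bar>real (card (big_vertices n k R')) - real (card (big_vertices n k R))\<bar> \<le> real (2 * k)"
proof -
  have mono: "big_vertices n k R \<subseteq> big_vertices n k R'"
    using cluster_ge_mono[of R R'] sub by (auto simp: big_vertices_def)
  define S where "S v = (if cluster_ge k R v then {} else cluster R v)" for v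
  have S: "finite (S v)" "card (S v) \<le> k" for v
    by (auto simp: S_def cluster_ge_def)
  have "big_vertices n k R' - big_vertices n k R \<subseteq> S a \<union> S b"
  proof
    fix v assume v: "v \<in> big_vertices n k R' - big_vertices n k R"
    then have ge: "cluster_ge k R' v" "\<not> cluster_ge k R v" by (auto simp: big_vertices_def)
    have "a \<in> cluster R v \<or> b \<in> cluster R v"
    proof (rule ccontr)
      assume "\<not> (a \<in> cluster R v \<or> b \<in> cluster R v)"
      then have "cluster R' v = cluster R v"
        using sub new by (intro cluster_add_edge_irrelevant) blast+
      then show False using ge by (simp add: cluster_ge_def)
    qed
    then obtain w where w: "w \<in> cluster R v" "w = a \<or> w = b" by blast
    then have "cluster R w = cluster R v" using cluster_eq[OF sym] by blast
    then have "v \<in> S w" using ge by (auto simp: S_def cluster_ge_def)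
    then show "v \<in> S a \<union> S b" using w by blast
  qed
  then have "card (big_vertices n k R' - big_vertices n k R) \<le> card (S a \<union> S b)"
    using S by (intro card_mono) auto
  also have "\<dots> \<le> 2 * k" using card_Un_le[of "S a" "S b"] S(2)[of a] S(2)[of b] by linarith
  finally have "card (big_vertices n k R') - card (big_vertices n k R) \<le> 2 * k"
    using mono by (simp add: card_Diff_subset)
  moreover have "card (big_vertices n k R) \<le> card (big_vertices n k R')"
    using mono by (intro card_mono) auto
  ultimately show ?thesis by linarith
qed

lemma symp_perc_graph:
  "finite_graph_on n G \<Longrightarrow> symp (perc_graph G c)"
  by (auto simp: symp_def finite_graph_on_def simple_graph_def perc_graph_def min.commute max.commute)

lemma perc_graph_bounded:
  "finite_graph_on n G \<Longrightarrow> perc_graph G c x y \<Longrightarrow> y < n"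
  by (auto simp: finite_graph_on_def perc_graph_def)

lemma card_edges_eq:
  assumes "finite_graph_on n G"
  shows "real (card {(u, w). G u w}) = real n * average_degree n G"
proof -
  have "{(u, w). G u w} = Sigma {..<n} (\<lambda>u. {w. w < n \<and> G u w})"
    using assms by (auto simp: finite_graph_on_def)
  then have "card {(u, w). G u w} = (\<Sum>v<n. card {w. w < n \<and> G v w})"
    by (simp add: card_SigmaI)
  then show ?thesis by (simp add: average_degree_def)
qed

lemma finite_edges: "finite_graph_on n G \<Longrightarrow> finite {(u, w). G u w}"
  by (rule finite_subset[of _ "{..<n} \<times> {..<n}"]) (auto simp: finite_graph_on_def)

lemma expectation_big_vertices:
  assumes "finite_graph_on n G"
  shows "measure_pmf.expectation (coins n p) (\<lambda>c. real (card (big_vertices n k (perc_graph G c))))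
    = (\<Sum>v<n. size_prob k p G v)"
proof -
  have fin: "finite (set_pmf (coins n p))" by (simp add: coins_def finite_set_Pi_pmf_bool)
  have "real (card (big_vertices n k (perc_graph G c)))
      = (\<Sum>v<n. indicator {c. cluster_ge k (perc_graph G c) v} c)" for c
  proof -
    have "big_vertices n k (perc_graph G c) = {v \<in> {..<n}. cluster_ge k (perc_graph G c) v}"
      by (auto simp: big_vertices_def)
    then show ?thesis by (simp add: indicator_def sum.If_cases Int_def)
  qed
  then show ?thesis
    by (simp add: Bochner_Integration.integral_sum integrable_measure_pmf_finite[OF fin] size_prob_eq_coins[OF assms])
qed

lemma big_vertices_concentration:
  assumes G: "finite_graph_on n G" and d: "average_degree n G \<le> d" and p: "0 \<le> p" "p \<le> 1"
    and "\<epsilon> > 0" "n > 0"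
  shows "measure_pmf.prob (coins n p)
      {c. \<bar>real (card (big_vertices n k (perc_graph G c))) / real n - (\<Sum>v<n. size_prob k p G v) / real n\<bar> \<ge> \<epsilon>}
    \<le> (2 * real k)\<^sup>2 * d / \<epsilon>\<^sup>2 / real n"
proof -
  let ?M = "coins n p" and ?A = "{0..<n} \<times> {0..<n}"
  let ?f = "\<lambda>c. real (card (big_vertices n k (perc_graph G c)))"
  have fin: "finite (set_pmf ?M)" by (simp add: coins_def finite_set_Pi_pmf_bool)
  define b where "b = (\<lambda>(u, w). if G u w then real (2 * k) else 0)"
  have infl: "\<bar>?f (c(i := True)) - ?f (c(i := False))\<bar> \<le> b i" for i c
  proof -
    obtain a a' where i: "i = (a, a')" by (cases i)
    show ?thesis
    proof (cases "G a a'")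
      case False
      then have "perc_graph G (c(i := True)) = perc_graph G (c(i := False))"
        using G by (auto simp: i perc_graph_def fun_eq_iff min_def max_def finite_graph_on_def simple_graph_def)
      then show ?thesis by (simp add: b_def i)
    next
      case True
      have "\<bar>?f (c(i := True)) - ?f (c(i := False))\<bar> \<le> real (2 * k)"
      proof (rule big_vertices_influence[of _ _ a a'])
        show "symp (perc_graph G (c(i := False)))"
          by (rule symp_perc_graph[OF G])
      qed (auto simp: perc_graph_def i min_def max_def split: if_splits)
      then show ?thesis using True by (simp add: b_def i)
    qed
  qed
  have "measure_pmf.variance ?M ?f \<le> (\<Sum>i\<in>?A. (b i)\<^sup>2)"
    unfolding coins_def using p infl by (intro variance_le_sum_influences) auto
  also have "\<dots> = (\<Sum>i\<in>{(u, w). G u w}. (2 * real k)\<^sup>2)"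
    using G by (intro sum.mono_neutral_cong_right) (auto simp: b_def finite_graph_on_def split: if_splits)
  also have "\<dots> = (real n * average_degree n G) * (2 * real k)\<^sup>2" by (simp add: card_edges_eq[OF G])
  also have "\<dots> \<le> (real n * d) * (2 * real k)\<^sup>2" using d by (intro mult_right_mono mult_left_mono) auto
  finally have var: "measure_pmf.variance ?M ?f \<le> (real n * d) * (2 * real k)\<^sup>2" .
  have "measure_pmf.prob ?M {c. \<bar>?f c / real n - (\<Sum>v<n. size_prob k p G v) / real n\<bar> \<ge> \<epsilon>}
      = measure_pmf.prob ?M {c \<in> space ?M. \<bar>?f c - measure_pmf.expectation ?M ?f\<bar> \<ge> \<epsilon> * real n}"
    using \<open>n > 0\<close> by (simp add: expectation_big_vertices[OF G] field_simps flip: diff_divide_distrib)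
  also have "\<dots> \<le> measure_pmf.variance ?M ?f / (\<epsilon> * real n)\<^sup>2"
    using assms by (intro measure_pmf.Chebyshev_inequality integrable_measure_pmf_finite fin) auto
  also have "\<dots> \<le> (real n * d) * (2 * real k)\<^sup>2 / (\<epsilon> * real n)\<^sup>2"
    using var by (intro divide_right_mono) auto
  also have "\<dots> = (2 * real k)\<^sup>2 * d / \<epsilon>\<^sup>2 / real n"
    using \<open>n > 0\<close> \<open>\<epsilon> > 0\<close> by (simp add: power2_eq_square field_simps)
  finally show ?thesis .
qed

section \<open>The infected set is a percolation cluster\<close>

lemma snd_sir_subset_fst: "snd (sir G c s t) \<subseteq> fst (sir G c s t)"
  by (cases t) (auto simp: Let_def)

lemma sir_final_eq_cluster: "sir_final G c s = cluster (\<lambda>u w. G u w \<and> c (u, w)) s"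
proof -
  let ?R = "\<lambda>u w. G u w \<and> c (u, w)"
  have 1: "fst (sir G c s t) \<subseteq> cluster ?R s" for t
  proof (induction t)
    case (Suc t)
    have "w \<in> cluster ?R s" if "u \<in> snd (sir G c s t)" "G u w" "c (u, w)" for u w
    proof -
      have "u \<in> cluster ?R s" using that snd_sir_subset_fst[of G c s t] Suc by blast
      then show ?thesis using that
        by (auto simp: cluster_def intro: rtranclp.rtrancl_into_rtrancl)
    qed
    then show ?case using Suc by (auto simp: Let_def)
  qed (simp add: cluster_def)
  have infectious: "u \<in> fst (sir G c s t) \<Longrightarrow> \<exists>t'. u \<in> snd (sir G c s t')" for u t
  proof (induction t)
    case 0
    then show ?case by (intro exI[of _ 0]) simp
  next
    case (Suc t)
    show ?case
    proof (cases "u \<in> fst (sir G c s t)")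
      case True
      then show ?thesis by (rule Suc.IH)
    next
      case False
      then have "u \<in> snd (sir G c s (Suc t))" using Suc.prems by (auto simp: Let_def)
      then show ?thesis by blast
    qed
  qed
  have "?R\<^sup>*\<^sup>* s w \<Longrightarrow> \<exists>t. w \<in> fst (sir G c s t)" for w
  proof (induction rule: rtranclp_induct)
    case base
    show ?case by (intro exI[of _ 0]) simp
  next
    case (step u w)
    then obtain t where "u \<in> snd (sir G c s t)" using infectious by blast
    then have "w \<in> fst (sir G c s (Suc t))" using step by (auto simp: Let_def)
    then show ?case by blast
  qed
  then show ?thesis using 1 by (auto simp: sir_final_def cluster_def)
qed

text \<open>The coins of the two orientations of an edge can be identified, one edge at a time: given all
  other coins, only one of the two orientations can influence the set reached from \<^term>\<open>s\<close>.\<close>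

definition mixed_graph :: "graph \<Rightarrow> (nat \<times> nat) set \<Rightarrow> (nat \<times> nat \<Rightarrow> bool) \<Rightarrow> graph" where
  "mixed_graph G F c = (\<lambda>u w. G u w \<and> c (if (min u w, max u w) \<in> F then (min u w, max u w) else (u, w)))"

lemma cluster_two_edges:
  fixes T :: "bool \<Rightarrow> bool \<Rightarrow> graph"
  assumes T: "\<And>x y u w. T x y u w \<longleftrightarrow> R u w \<or> x \<and> E \<and> u = a \<and> w = b \<or> y \<and> E' \<and> u = b \<and> w = a"
  shows "(\<forall>x y. cluster (T x y) s = cluster (T x x) s) \<or> (\<forall>x y. cluster (T x y) s = cluster (T y y) s)"
proof -
  have mono: "cluster (T x y) s \<subseteq> cluster (T x' y') s" if "x \<longrightarrow> x'" "y \<longrightarrow> y'" for x y x' y'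
    using that by (intro cluster_mono) (auto simp: T)
  show ?thesis
  proof (cases "a \<in> cluster (T False False) s")
    case True
    have "cluster (T x True) s = cluster (T x False) s" for x
    proof (rule cluster_add_edge_irrelevant)
      have "a \<in> cluster (T x False) s" using True mono[of False x False False] by auto
      then show "T x False u w \<or> w \<in> cluster (T x False) s" if "T x True u w" for u w
        using that by (auto simp: T)
    qed (auto simp: T)
    then have "\<forall>x y. cluster (T x y) s = cluster (T x x) s" by (metis (full_types))
    then show ?thesis ..
  next
    case False
    have "cluster (T True y) s = cluster (T False y) s" for y
    proof (rule cluster_add_edge_irrelevant)
      have "b \<in> cluster (T False y) s" if a: "a \<in> cluster (T False y) s"
      proof (rule ccontr)
        assume b: "b \<notin> cluster (T False y) s"
        have "cluster (T False y) s = cluster (T False False) s"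
          using b mono[of False False False y] by (intro cluster_add_edge_irrelevant) (auto simp: T)
        then show False using a False by simp
      qed
      then show "T False y u w \<or> w \<in> cluster (T False y) s" if "u \<in> cluster (T False y) s" "T True y u w" for u w
        using that by (auto simp: T)
    qed (auto simp: T)
    then have "\<forall>x y. cluster (T x y) s = cluster (T y y) s" by (metis (full_types))
    then show ?thesis ..
  qed
qed

lemma mixed_graph_insert:
  fixes p :: real
  assumes A: "finite A" "(a, b) \<in> A" "(b, a) \<in> A" and ab: "a < b" "(a, b) \<notin> F"
  defines "M \<equiv> Pi_pmf A False (\<lambda>_. bernoulli_pmf p)"
  shows "map_pmf (\<lambda>c. cluster (mixed_graph G (insert (a, b) F) c) s) M
    = map_pmf (\<lambda>c. cluster (mixed_graph G F c) s) M"
proof -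
  let ?B = "bernoulli_pmf p"
  define A' where "A' = A - {(a, b), (b, a)}"
  let ?Q = "Pi_pmf A' False (\<lambda>_. ?B)"
  have A_eq: "A = insert (a, b) (insert (b, a) A')" using A by (auto simp: A'_def)
  have fin: "finite A'" using A by (simp add: A'_def)
  have M: "M = do {x \<leftarrow> ?B; y \<leftarrow> ?B; g \<leftarrow> ?Q; return_pmf (g((b, a) := y, (a, b) := x))}"
    unfolding M_def A_eq using fin ab
    by (subst Pi_pmf_insert', simp, simp add: A'_def, subst Pi_pmf_insert')
       (auto simp: A'_def bind_assoc_pmf bind_return_pmf)
  have expand: "map_pmf h M = do {g \<leftarrow> ?Q; x \<leftarrow> ?B; y \<leftarrow> ?B; return_pmf (h (g((b, a) := y, (a, b) := x)))}"
    for h :: "_ \<Rightarrow> nat set"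
  proof -
    have "map_pmf h M = do {x \<leftarrow> ?B; y \<leftarrow> ?B; g \<leftarrow> ?Q; return_pmf (h (g((b, a) := y, (a, b) := x)))}"
      unfolding M by (simp add: map_pmf_def bind_assoc_pmf bind_return_pmf)
    also have "\<dots> = do {x \<leftarrow> ?B; g \<leftarrow> ?Q; y \<leftarrow> ?B; return_pmf (h (g((b, a) := y, (a, b) := x)))}"
      by (intro bind_pmf_cong refl bind_commute_pmf)
    also have "\<dots> = do {g \<leftarrow> ?Q; x \<leftarrow> ?B; y \<leftarrow> ?B; return_pmf (h (g((b, a) := y, (a, b) := x)))}"
      by (rule bind_commute_pmf)
    finally show ?thesis .
  qed
  show ?thesis
    unfolding expand
  proof (rule bind_pmf_cong[OF refl])
    fix g :: "nat \<times> nat \<Rightarrow> bool"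
    define T where "T x y = mixed_graph G F (g((b, a) := y, (a, b) := x))" for x y
    define R where "R = mixed_graph G F (g((b, a) := False, (a, b) := False))"
    have T: "T x y u w \<longleftrightarrow> R u w \<or> x \<and> G a b \<and> u = a \<and> w = b \<or> y \<and> G b a \<and> u = b \<and> w = a" for x y u w
      using ab by (auto simp: T_def R_def mixed_graph_def min_def max_def)
    have T': "mixed_graph G (insert (a, b) F) (g((b, a) := y, (a, b) := x)) = T x x" for x y
      using ab by (auto simp: T_def mixed_graph_def fun_eq_iff min_def max_def)
    let ?C = "\<lambda>x y. cluster (T x y) s"
    consider "\<And>x y. ?C x y = ?C x x" | "\<And>x y. ?C x y = ?C y y"
      using cluster_two_edges[of T R "G a b" a b "G b a" s, OF T] by blast
    then have "do {x \<leftarrow> ?B; y \<leftarrow> ?B; return_pmf (?C x x)} = do {x \<leftarrow> ?B; y \<leftarrow> ?B; return_pmf (?C x y)}"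
    proof cases
      case 1
      then show ?thesis by (intro bind_pmf_cong refl arg_cong[of _ _ return_pmf]) metis
    next
      case 2
      have "do {x \<leftarrow> ?B; y \<leftarrow> ?B; return_pmf (?C x y)} = do {x \<leftarrow> ?B; y \<leftarrow> ?B; return_pmf (?C y y)}"
        using 2 by (intro bind_pmf_cong refl arg_cong[of _ _ return_pmf]) metis
      then show ?thesis by (simp add: bind_pmf_const)
    qed
    then show "do {x \<leftarrow> ?B; y \<leftarrow> ?B;
          return_pmf (cluster (mixed_graph G (insert (a, b) F) (g((b, a) := y, (a, b) := x))) s)}
        = do {x \<leftarrow> ?B; y \<leftarrow> ?B; return_pmf (cluster (mixed_graph G F (g((b, a) := y, (a, b) := x))) s)}"
      unfolding T' by (simp add: T_def)
  qed
qed

lemma sir_final_law: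
  assumes G: "finite_graph_on n G"
  shows "map_pmf (\<lambda>c. sir_final G c s) (coins n p) = map_pmf (\<lambda>c. cluster (perc_graph G c) s) (coins n p)"
proof -
  let ?E = "{(x, y). x < y \<and> y < n}"
  have "finite ?E" by (rule finite_subset[of _ "{..<n} \<times> {..<n}"]) auto
  have "F \<subseteq> ?E \<Longrightarrow> map_pmf (\<lambda>c. cluster (mixed_graph G F c) s) (coins n p)
      = map_pmf (\<lambda>c. cluster (mixed_graph G {} c) s) (coins n p)" if "finite F" for F
    using that
  proof (induction F)
    case (insert e F)
    obtain a b where e: "e = (a, b)" by (cases e)
    have "map_pmf (\<lambda>c. cluster (mixed_graph G (insert (a, b) F) c) s) (coins n p)
      = map_pmf (\<lambda>c. cluster (mixed_graph G F c) s) (coins n p)"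
      unfolding coins_def using insert e by (intro mixed_graph_insert) auto
    then show ?case using insert e by simp
  qed simp
  from this[OF \<open>finite ?E\<close> order_refl]
  have "map_pmf (\<lambda>c. cluster (mixed_graph G ?E c) s) (coins n p)
      = map_pmf (\<lambda>c. cluster (mixed_graph G {} c) s) (coins n p)" .
  moreover have "mixed_graph G ?E c = perc_graph G c" for c
  proof (intro ext)
    fix u w
    show "mixed_graph G ?E c u w = perc_graph G c u w"
    proof (cases "G u w")
      case True
      then have "u \<noteq> w" "u < n" "w < n" using G by (auto simp: finite_graph_on_def simple_graph_def)
      then have "(min u w, max u w) \<in> ?E" by (auto simp: min_def max_def)
      then show ?thesis by (simp add: mixed_graph_def perc_graph_def)
    qed (simp add: mixed_graph_def perc_graph_def)
  qed
  moreover have "mixed_graph G {} c = (\<lambda>u w. G u w \<and> c (u, w))" for c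
    by (simp add: mixed_graph_def)
  ultimately show ?thesis by (simp add: sir_final_eq_cluster)
qed

lemma sir_count_eq:
  assumes "\<And>G. G \<in> set_pmf (Gs n) \<Longrightarrow> finite_graph_on n G"
  shows "sir_count Gs p n = do {
     G \<leftarrow> Gs n;
     c \<leftarrow> coins n p;
     map_pmf (\<lambda>s. card (cluster (perc_graph G c) s)) (pmf_of_set {0..<n}) }"
  unfolding sir_count_def
proof (rule bind_pmf_cong[OF refl])
  fix G assume "G \<in> set_pmf (Gs n)"
  then have G: "finite_graph_on n G" by (rule assms)
  have "do {s \<leftarrow> pmf_of_set {0..<n}; c \<leftarrow> coins n p; return_pmf (card (sir_final G c s))}
      = do {s \<leftarrow> pmf_of_set {0..<n}; map_pmf card (map_pmf (\<lambda>c. sir_final G c s) (coins n p))}"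
    by (simp add: map_pmf_def bind_assoc_pmf bind_return_pmf)
  also have "\<dots> = do {s \<leftarrow> pmf_of_set {0..<n}; c \<leftarrow> coins n p; return_pmf (card (cluster (perc_graph G c) s))}"
    unfolding sir_final_law[OF G] by (simp add: map_pmf_def bind_assoc_pmf bind_return_pmf)
  also have "\<dots> = do {c \<leftarrow> coins n p; s \<leftarrow> pmf_of_set {0..<n}; return_pmf (card (cluster (perc_graph G c) s))}"
    by (rule bind_commute_pmf)
  finally show "do {s \<leftarrow> pmf_of_set {0..<n};
       c \<leftarrow> Pi_pmf ({0..<n} \<times> {0..<n}) False (\<lambda>_. bernoulli_pmf p);
       return_pmf (card (sir_final G c s))}
    = do {c \<leftarrow> coins n p; map_pmf (\<lambda>s. card (cluster (perc_graph G c) s)) (pmf_of_set {0..<n})}"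
    by (simp add: map_pmf_def coins_def)
qed

section \<open>Edge-disjoint short connections in expanders\<close>

lemma expander_cut:
  assumes G: "finite_graph_on n G" and exp: "large_set_expander \<alpha> \<delta> d n G" and "\<alpha> > 0"
    and S: "S \<subseteq> {0..<n}" "A \<subseteq> S" "B \<subseteq> {0..<n}" "S \<inter> B = {}"
    and A: "\<delta> * real n \<le> real (card A)" and B: "\<delta> * real n \<le> real (card B)"
  shows "\<alpha> * (\<delta> * real n) \<le> real (card {(u, w). u \<in> S \<and> w \<in> {0..<n} - S \<and> G u w})"
proof -
  let ?S' = "{0..<n} - S"
  have E: "\<alpha> * real (card T) \<le> real (edges_between G T ({0..<n} - T))"
    if "T \<subseteq> {0..<n}" "\<delta> * real n \<le> real (card T)" "real (card T) \<le> real n / 2" for T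
    using exp that by (simp add: large_set_expander_def)
  have finS: "finite S" using S finite_subset by blast
  have "card A \<le> card S" using finS S by (intro card_mono) auto
  then have S1: "\<delta> * real n \<le> real (card S)" using A by linarith
  have "card B \<le> card ?S'" using S by (intro card_mono) auto
  then have S2: "\<delta> * real n \<le> real (card ?S')" using B by linarith
  have sum: "real (card S) + real (card ?S') = real n"
    using S finS card_mono[of "{0..<n}" S] by (simp add: card_Diff_subset of_nat_diff)
  show ?thesis
  proof (cases "real (card S) \<le> real n / 2")
    case True
    then have "\<alpha> * real (card S) \<le> real (edges_between G S ?S')"
      using S S1 by (intro E) auto
    moreover have "\<alpha> * (\<delta> * real n) \<le> \<alpha> * real (card S)" using S1 \<open>\<alpha> > 0\<close> by simp
    ultimately show ?thesis by (simp add: edges_between_def)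
  next
    case False
    then have "real (card ?S') \<le> real n / 2" using sum by linarith
    then have "\<alpha> * real (card ?S') \<le> real (edges_between G ?S' ({0..<n} - ?S'))"
      using S2 by (intro E) auto
    moreover have "\<alpha> * (\<delta> * real n) \<le> \<alpha> * real (card ?S')" using S2 \<open>\<alpha> > 0\<close> by simp
    moreover have "edges_between G ?S' ({0..<n} - ?S') = card {(u, w). u \<in> S \<and> w \<in> ?S' \<and> G u w}"
    proof -
      have "{(u, w). u \<in> ?S' \<and> w \<in> {0..<n} - ?S' \<and> G u w} = prod.swap ` {(u, w). u \<in> S \<and> w \<in> ?S' \<and> G u w}"
        using G S by (auto simp: finite_graph_on_def simple_graph_def image_iff)
      then show ?thesis by (simp add: edges_between_def card_image)
    qed
    ultimately show ?thesis by simp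
  qed
qed

lemma path_edge_set:
  assumes G: "finite_graph_on n G" and "((\<lambda>x y. G x y \<and> (min x y, max x y) \<notin> U) ^^ j) u w"
  shows "\<exists>P. P \<subseteq> {0..<n} \<times> {0..<n} \<and> card P \<le> j \<and> P \<inter> U = {} \<and> w \<in> cluster (perc_graph G (\<lambda>e. e \<in> P)) u"
  using assms(2)
proof (induction j arbitrary: w)
  case 0
  then show ?case by (intro exI[of _ "{}"]) auto
next
  case (Suc j)
  let ?H = "\<lambda>x y. G x y \<and> (min x y, max x y) \<notin> U"
  obtain v where v: "(?H ^^ j) u v" "?H v w" using Suc.prems by auto
  obtain P where P: "P \<subseteq> {0..<n} \<times> {0..<n}" "card P \<le> j" "P \<inter> U = {}"
    "v \<in> cluster (perc_graph G (\<lambda>e. e \<in> P)) u"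
    using Suc.IH[OF v(1)] by blast
  let ?e = "(min v w, max v w)"
  let ?P = "insert ?e P"
  have "?e \<in> {0..<n} \<times> {0..<n}" using v G by (auto simp: finite_graph_on_def min_def max_def)
  moreover have "card ?P \<le> Suc j" using P card_insert_le_m1[of "Suc j" P ?e] by auto
  moreover have "v \<in> cluster (perc_graph G (\<lambda>e. e \<in> ?P)) u"
    using P(4) cluster_mono[of "perc_graph G (\<lambda>e. e \<in> P)" "perc_graph G (\<lambda>e. e \<in> ?P)" u]
    by (auto simp: perc_graph_def)
  then have "w \<in> cluster (perc_graph G (\<lambda>e. e \<in> ?P)) u"
    using v by (auto simp: cluster_def perc_graph_def intro: rtranclp.rtrancl_into_rtrancl)
  ultimately show ?case using P v by (intro exI[of _ ?P]) auto
qed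

text \<open>Take a maximal family of edge-disjoint paths of length at most \<^term>\<open>L\<close> from \<^term>\<open>A\<close> to
  \<^term>\<open>B\<close> and delete their edges. The first \<^term>\<open>L\<close> balls around \<^term>\<open>A\<close> in the remaining graph
  avoid \<^term>\<open>B\<close> and have disjoint edge boundaries, so one of these boundaries is small. By expansion
  the deleted edges make up for it, hence there are many paths.\<close>

lemma many_disjoint_connections:
  fixes L :: nat
  assumes G: "finite_graph_on n G" and exp: "large_set_expander \<alpha> \<delta> d n G" and "\<alpha> > 0"
    and A: "A \<subseteq> {0..<n}" and B: "B \<subseteq> {0..<n}" and AB: "A \<inter> B = {}"
    and cA: "\<delta> * real n \<le> real (card A)" and cB: "\<delta> * real n \<le> real (card B)"
  obtains \<P> where "finite \<P>" "disjoint \<P>"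
    "\<And>P. P \<in> \<P> \<Longrightarrow> P \<subseteq> {0..<n} \<times> {0..<n} \<and> card P \<le> L \<and> (\<exists>u\<in>A. \<exists>w\<in>B. w \<in> cluster (perc_graph G (\<lambda>e. e \<in> P)) u)"
    "real L * (\<alpha> * (\<delta> * real n) - real L * real (card \<P>)) \<le> d * real n"
proof -
  let ?E = "{0..<n} \<times> {0..<n}"
  let ?conn = "\<lambda>P. \<exists>u\<in>A. \<exists>w\<in>B. w \<in> cluster (perc_graph G (\<lambda>e. e \<in> P)) u"
  let ?key = "\<lambda>(u, w). (min u w, max u w)"
  define ok where "ok \<P> \<longleftrightarrow> \<P> \<subseteq> {P. P \<subseteq> ?E \<and> card P \<le> L \<and> ?conn P} \<and> disjoint \<P>" for \<P>
  have fin_ok: "finite {\<P>. ok \<P>}"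
    by (rule finite_subset[of _ "Pow (Pow ?E)"]) (auto simp: ok_def)
  have "ok {}" by (auto simp: ok_def disjoint_def)
  then obtain \<P> where \<P>: "ok \<P>" and max: "\<And>\<Q>. ok \<Q> \<Longrightarrow> card \<Q> \<le> card \<P>"
  proof -
    have "Max (card ` {\<P>. ok \<P>}) \<in> card ` {\<P>. ok \<P>}"
      using fin_ok \<open>ok {}\<close> by (intro Max_in) auto
    then obtain \<P> where "ok \<P>" "card \<P> = Max (card ` {\<P>. ok \<P>})" by auto
    then show thesis using that fin_ok by simp
  qed
  have fin: "finite \<P>"
    by (rule finite_subset[of _ "Pow ?E"]) (use \<P> in \<open>auto simp: ok_def\<close>)
  define U where "U = \<Union>\<P>"
  have "U \<subseteq> ?E" using \<P> by (auto simp: U_def ok_def)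
  then have finU: "finite U" by (rule finite_subset) simp
  have "card U \<le> (\<Sum>P\<in>\<P>. card P)" unfolding U_def by (rule card_Union_le_sum_card)
  also have "\<dots> \<le> (\<Sum>P\<in>\<P>. L)" using \<P> by (intro sum_mono) (auto simp: ok_def)
  finally have cU: "card U \<le> L * card \<P>" by (simp add: mult.commute)
  define H where "H = (\<lambda>x y. G x y \<and> (min x y, max x y) \<notin> U)"
  define S where "S i = (\<Union>u\<in>A. gball i H u)" for i
  have S_Suc: "S (Suc i) = S i \<union> {w. \<exists>u\<in>S i. H u w}" for i
    unfolding S_def gball_Suc by auto
  have "S 0 = A" by (auto simp: S_def gball_def)
  have S_mono: "i \<le> j \<Longrightarrow> S i \<subseteq> S j" for i j
    by (rule lift_Suc_mono_le[of S]) (auto simp: S_Suc)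
  have S_V: "S i \<subseteq> {0..<n}" for i
  proof (induction i)
    case 0
    show ?case using \<open>S 0 = A\<close> A by simp
  next
    case (Suc i)
    then show ?case using G by (auto simp: S_Suc H_def finite_graph_on_def)
  qed
  have S_B: "S i \<inter> B = {}" if "i \<le> L" for i
  proof (rule ccontr)
    assume "S i \<inter> B \<noteq> {}"
    then obtain u w j where "u \<in> A" "w \<in> B" "j \<le> i" "(H ^^ j) u w"
      by (auto simp: S_def gball_def)
    then obtain P where P: "P \<subseteq> ?E" "card P \<le> j" "P \<inter> U = {}" "w \<in> cluster (perc_graph G (\<lambda>e. e \<in> P)) u"
      using path_edge_set[OF G, where U = U and j = j and u = u and w = w] unfolding H_def by blast
    have "P \<noteq> {}"
    proof
      assume "P = {}"
      then have "perc_graph G (\<lambda>e. e \<in> P) = (\<lambda>_ _. False)" by (auto simp: perc_graph_def)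
      then have "w = u" using P(4) by (auto simp: cluster_def elim: rtranclp.cases)
      then show False using \<open>u \<in> A\<close> \<open>w \<in> B\<close> AB by blast
    qed
    then have "P \<notin> \<P>" using P(3) by (auto simp: U_def)
    have "ok (insert P \<P>)"
      using \<P> P \<open>u \<in> A\<close> \<open>w \<in> B\<close> \<open>j \<le> i\<close> that
      by (auto simp: ok_def disjoint_def U_def)
    then show False using max[of "insert P \<P>"] fin \<open>P \<notin> \<P>\<close> by simp
  qed
  have layer: "\<alpha> * (\<delta> * real n) - real (card U) \<le> real (card {(u, w). w \<in> S (Suc i) - S i \<and> G u w})"
    if "i < L" for i
  proof -
    let ?D = "{(u, w). u \<in> S i \<and> w \<in> {0..<n} - S i \<and> G u w}"
    let ?T = "{(u, w). w \<in> S (Suc i) - S i \<and> G u w}"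
    let ?DU = "{e \<in> ?D. ?key e \<in> U}"
    have finT: "finite ?T" by (rule finite_subset[OF _ finite_edges[OF G]]) auto
    have finD: "finite ?D" by (rule finite_subset[OF _ finite_edges[OF G]]) auto
    have "\<alpha> * (\<delta> * real n) \<le> real (card ?D)"
      using S_V[of i] S_B[of i] S_mono[of 0 i] \<open>S 0 = A\<close> that B
      by (intro expander_cut[OF G exp \<open>\<alpha> > 0\<close> _ _ _ _ cA cB]) auto
    moreover have "?D \<subseteq> ?DU \<union> ?T" by (auto simp: S_Suc H_def)
    then have "card ?D \<le> card (?DU \<union> ?T)" using finT finD by (intro card_mono) auto
    then have "card ?D \<le> card ?DU + card ?T" using card_Un_le[of ?DU ?T] by linarith
    moreover have "card ?DU \<le> card U"
    proof (rule card_inj_on_le[of ?key])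
      show "inj_on ?key ?DU"
        by (auto simp: inj_on_def min_def max_def split: if_splits)
    qed (use finU in auto)
    ultimately show ?thesis by linarith
  qed
  have "(\<Sum>i<L. card {(u, w). w \<in> S (Suc i) - S i \<and> G u w}) = card (\<Union>i<L. {(u, w). w \<in> S (Suc i) - S i \<and> G u w})"
  proof (rule card_UN_disjoint[symmetric])
    show "\<forall>i\<in>{..<L}. finite {(u, w). w \<in> S (Suc i) - S i \<and> G u w}"
      by (auto intro: finite_subset[OF _ finite_edges[OF G]])
    have "w \<notin> S (Suc j) - S j" if "w \<in> S (Suc i) - S i" "i < j" for w i j
      using that S_mono[of "Suc i" j] by auto
    then have "(S (Suc i) - S i) \<inter> (S (Suc j) - S j) = {}" if "i \<noteq> j" for i j
      using that by (cases i j rule: linorder_cases) blast+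
    then show "\<forall>i\<in>{..<L}. \<forall>j\<in>{..<L}. i \<noteq> j \<longrightarrow>
        {(u, w). w \<in> S (Suc i) - S i \<and> G u w} \<inter> {(u, w). w \<in> S (Suc j) - S j \<and> G u w} = {}"
      by blast
  qed simp
  also have "\<dots> \<le> card {(u, w). G u w}" by (intro card_mono finite_edges[OF G]) auto
  finally have "real (\<Sum>i<L. card {(u, w). w \<in> S (Suc i) - S i \<and> G u w}) \<le> real n * average_degree n G"
    using card_edges_eq[OF G] by linarith
  moreover have "(\<Sum>i<L. \<alpha> * (\<delta> * real n) - real (card U)) \<le> (\<Sum>i<L. real (card {(u, w). w \<in> S (Suc i) - S i \<and> G u w}))"
    by (intro sum_mono layer) auto
  moreover have "real n * average_degree n G \<le> real n * d"
    using exp by (intro mult_left_mono) (auto simp: large_set_expander_def)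
  ultimately have "real L * (\<alpha> * (\<delta> * real n) - real (card U)) \<le> d * real n"
    by (simp add: mult.commute)
  moreover have "real L * (\<alpha> * (\<delta> * real n) - real L * real (card \<P>)) \<le> real L * (\<alpha> * (\<delta> * real n) - real (card U))"
    using cU by (intro mult_left_mono diff_left_mono) (auto simp flip: of_nat_mult)
  ultimately have "real L * (\<alpha> * (\<delta> * real n) - real L * real (card \<P>)) \<le> d * real n" by linarith
  then show thesis using that[of \<P>] fin \<P> unfolding ok_def by blast
qed

lemma prob_no_set_open:
  assumes "finite \<P>" "disjoint \<P>" "\<And>P. P \<in> \<P> \<Longrightarrow> P \<subseteq> A" "finite A" and q: "0 \<le> q" "q \<le> 1"
  shows "measure_pmf.prob (Pi_pmf A False (\<lambda>_. bernoulli_pmf q)) {c. \<forall>P\<in>\<P>. \<exists>e\<in>P. \<not> c e}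
    = (\<Prod>P\<in>\<P>. 1 - q ^ card P)"
  using assms(1-4)
proof (induction \<P> arbitrary: A)
  case empty
  then show ?case by simp
next
  case (insert P \<P>)
  let ?M = "\<lambda>A. Pi_pmf A False (\<lambda>_. bernoulli_pmf q)"
  have P: "P \<subseteq> A" using insert.prems by auto
  then have "finite P" using \<open>finite A\<close> by (rule finite_subset)
  note P = P this
  have disj: "Q \<inter> P = {}" if "Q \<in> \<P>" for Q
    using that insert by (auto simp: disjoint_def)
  have A_eq: "A = P \<union> (A - P)" using P by blast
  have fin: "finite (set_pmf (?M B))" if "finite B" for B by (rule finite_set_Pi_pmf_bool[OF that])
  let ?E1 = "{c. \<exists>e\<in>P. \<not> c e} \<inter> set_pmf (?M P)"
  let ?E2 = "{c. \<forall>Q\<in>\<P>. \<exists>e\<in>Q. \<not> c e} \<inter> set_pmf (?M (A - P))"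
  let ?h = "\<lambda>(f, g) x. if x \<in> P then f x else g x"
  let ?pair = "pair_pmf (?M P) (?M (A - P))"
  have "?M A = map_pmf ?h ?pair"
    by (subst A_eq, rule Pi_pmf_union) (use P insert.prems in auto)
  then have "measure_pmf.prob (?M A) {c. \<forall>P\<in>insert P \<P>. \<exists>e\<in>P. \<not> c e}
      = measure_pmf.prob ?pair (?h -` {c. \<forall>P\<in>insert P \<P>. \<exists>e\<in>P. \<not> c e})"
    by simp
  also have "?h -` {c. \<forall>P\<in>insert P \<P>. \<exists>e\<in>P. \<not> c e} = {c. \<exists>e\<in>P. \<not> c e} \<times> {c. \<forall>Q\<in>\<P>. \<exists>e\<in>Q. \<not> c e}"
  proof (rule set_eqI)
    fix z :: "('a \<Rightarrow> bool) \<times> ('a \<Rightarrow> bool)"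
    obtain f g where z: "z = (f, g)" by (cases z)
    have 1: "(\<exists>e\<in>P. \<not> (if e \<in> P then f e else g e)) \<longleftrightarrow> (\<exists>e\<in>P. \<not> f e)"
      by (intro bex_cong refl) auto
    have "(\<exists>e\<in>Q. \<not> (if e \<in> P then f e else g e)) \<longleftrightarrow> (\<exists>e\<in>Q. \<not> g e)" if "Q \<in> \<P>" for Q
      using disj[OF that] by (intro bex_cong refl) auto
    then have 2: "(\<forall>Q\<in>\<P>. \<exists>e\<in>Q. \<not> (if e \<in> P then f e else g e)) \<longleftrightarrow> (\<forall>Q\<in>\<P>. \<exists>e\<in>Q. \<not> g e)"
      by (intro ball_cong refl)
    show "z \<in> ?h -` {c. \<forall>P\<in>insert P \<P>. \<exists>e\<in>P. \<not> c e} \<longleftrightarrow>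
        z \<in> {c. \<exists>e\<in>P. \<not> c e} \<times> {c. \<forall>Q\<in>\<P>. \<exists>e\<in>Q. \<not> c e}"
      unfolding z vimage_eq mem_Collect_eq mem_Times_iff prod.case fst_conv snd_conv 1[symmetric] 2[symmetric]
      by blast
  qed
  also have "measure_pmf.prob ?pair \<dots> = measure_pmf.prob ?pair (\<dots> \<inter> set_pmf ?pair)"
    by (rule measure_Int_set_pmf[symmetric])
  also have "({c. \<exists>e\<in>P. \<not> c e} \<times> {c. \<forall>Q\<in>\<P>. \<exists>e\<in>Q. \<not> c e}) \<inter> set_pmf ?pair = ?E1 \<times> ?E2"
    by (simp only: set_pair_pmf Times_Int_Times)
  also have "measure_pmf.prob ?pair \<dots> = measure_pmf.prob (?M P) ?E1 * measure_pmf.prob (?M (A - P)) ?E2"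
    using fin[OF P(2)] fin[of "A - P"] insert.prems
    by (intro measure_pmf_prob_product countable_finite) auto
  also have "measure_pmf.prob (?M P) ?E1 = measure_pmf.prob (?M P) {c. \<exists>e\<in>P. \<not> c e}"
    by (rule measure_Int_set_pmf)
  also have "\<dots> = 1 - q ^ card P"
  proof -
    have "measure_pmf.prob (?M P) {c. \<exists>e\<in>P. \<not> c e} = measure_pmf.prob (?M P) (space (?M P) - Pi P (\<lambda>_. {True}))"
      by (rule arg_cong[where f = "measure_pmf.prob (?M P)"]) auto
    also have "\<dots> = 1 - measure_pmf.prob (?M P) (Pi P (\<lambda>_. {True}))"
      by (rule measure_pmf.prob_compl) simp
    also have "measure_pmf.prob (?M P) (Pi P (\<lambda>_. {True})) = q ^ card P"
      using P q by (simp add: measure_Pi_pmf_Pi measure_pmf_single)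
    finally show ?thesis .
  qed
  also have "measure_pmf.prob (?M (A - P)) ?E2 = measure_pmf.prob (?M (A - P)) {c. \<forall>Q\<in>\<P>. \<exists>e\<in>Q. \<not> c e}"
    by (rule measure_Int_set_pmf)
  also have "\<dots> = (\<Prod>P\<in>\<P>. 1 - q ^ card P)"
  proof (rule insert.IH)
    show "disjoint \<P>" using insert.prems(1) by (auto simp: disjoint_def)
    show "Q \<subseteq> A - P" if "Q \<in> \<P>" for Q using that disj insert.prems by auto
  qed (use insert.prems in auto)
  finally show ?case using insert by simp
qed

section \<open>Sprinkling\<close>

lemma prob_bind_pmf:
  "measure_pmf.prob (bind_pmf M f) E = measure_pmf.expectation M (\<lambda>x. measure_pmf.prob (f x) E)"
proof -
  have as_pmf: "measure_pmf.prob Q E = pmf (map_pmf (\<lambda>x. x \<in> E) Q) True" for Q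
    by (simp add: pmf_map vimage_def)
  show ?thesis unfolding as_pmf map_bind_pmf pmf_bind by simp
qed

lemma prob_bind_pmf_le:
  assumes "\<And>x. x \<in> set_pmf M \<Longrightarrow> x \<notin> Bad \<Longrightarrow> measure_pmf.prob (f x) E \<le> \<epsilon>" "0 \<le> \<epsilon>"
  shows "measure_pmf.prob (bind_pmf M f) E \<le> measure_pmf.prob M Bad + \<epsilon>"
proof -
  have int: "integrable (measure_pmf M) (\<lambda>x. measure_pmf.prob (f x) E)"
    by (rule measure_pmf.integrable_const_bound[where B = 1]) auto
  have int2: "integrable (measure_pmf M) (\<lambda>x. indicator Bad x + \<epsilon>)"
    by (rule measure_pmf.integrable_const_bound[where B = "1 + \<epsilon>"]) (use assms(2) in \<open>auto simp: indicator_def\<close>)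
  have "measure_pmf.prob (bind_pmf M f) E \<le> measure_pmf.expectation M (\<lambda>x. indicator Bad x + \<epsilon>)"
    unfolding prob_bind_pmf
  proof (rule integral_mono_AE[OF int int2], rule AE_pmfI)
    fix x assume "x \<in> set_pmf M"
    then show "measure_pmf.prob (f x) E \<le> indicator Bad x + \<epsilon>"
      using assms(1)[of x] assms(2) measure_pmf.prob_le_1[of "f x" E] by (cases "x \<in> Bad") (auto intro: order_trans)
  qed
  also have "\<dots> = measure_pmf.prob M Bad + \<epsilon>"
    by (subst Bochner_Integration.integral_add) (auto simp: less_top[symmetric])
  finally show ?thesis .
qed

lemma bernoulli_pmf_or:
  assumes "0 \<le> p" "p \<le> 1" "0 \<le> q" "q \<le> 1"
  shows "bernoulli_pmf (p + (1 - p) * q) = bind_pmf (bernoulli_pmf p) (\<lambda>b. bind_pmf (bernoulli_pmf q) (\<lambda>b'. return_pmf (b \<or> b')))"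
proof -
  have "p + (1 - p) * q \<le> 1" using assms mult_left_le[of q "1 - p"] by simp
  then have r: "0 \<le> p + (1 - p) * q" "p + (1 - p) * q \<le> 1" using assms by auto
  show ?thesis
  proof (rule pmf_eqI)
    fix x
    show "pmf (bernoulli_pmf (p + (1 - p) * q)) x
        = pmf (bind_pmf (bernoulli_pmf p) (\<lambda>b. bind_pmf (bernoulli_pmf q) (\<lambda>b'. return_pmf (b \<or> b')))) x"
      using assms r by (cases x) (simp_all add: pmf_bind algebra_simps)
  qed
qed

lemma coins_sprinkle:
  assumes "0 \<le> p" "p \<le> 1" "0 \<le> q" "q \<le> 1"
  shows "coins n (p + (1 - p) * q) = do {c \<leftarrow> coins n p; c' \<leftarrow> coins n q; return_pmf (\<lambda>e. c e \<or> c' e)}"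
proof -
  let ?A = "{0..<n} \<times> {0..<n}"
  have "coins n (p + (1 - p) * q) = do {c \<leftarrow> coins n p;
      Pi_pmf ?A False (\<lambda>e. bind_pmf (bernoulli_pmf q) (\<lambda>b'. return_pmf (c e \<or> b')))}"
    unfolding coins_def bernoulli_pmf_or[OF assms] by (rule Pi_pmf_bind) simp
  also have "\<dots> = do {c \<leftarrow> coins n p; c' \<leftarrow> coins n q; return_pmf (\<lambda>e. c e \<or> c' e)}"
  proof (rule bind_pmf_cong[OF refl])
    fix c assume c: "c \<in> set_pmf (coins n p)"
    have sub: "set_pmf (coins n r) \<subseteq> {f. \<forall>x. x \<notin> ?A \<longrightarrow> f x = False}" for r
      unfolding coins_def by (rule set_Pi_pmf_subset) simp
    have "Pi_pmf ?A False (\<lambda>e. bind_pmf (bernoulli_pmf q) (\<lambda>b'. return_pmf (c e \<or> b')))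
      = do {c' \<leftarrow> coins n q; Pi_pmf ?A False (\<lambda>e. return_pmf (c e \<or> c' e))}"
      unfolding coins_def by (rule Pi_pmf_bind) simp
    also have "\<dots> = do {c' \<leftarrow> coins n q; return_pmf (\<lambda>e. c e \<or> c' e)}"
    proof (rule bind_pmf_cong[OF refl])
      fix c' assume c': "c' \<in> set_pmf (coins n q)"
      have "\<not> c e" "\<not> c' e" if "e \<notin> ?A" for e using c c' sub that by blast+
      then have "(\<lambda>e. if e \<in> ?A then c e \<or> c' e else False) = (\<lambda>e. c e \<or> c' e)" by fastforce
      moreover have "Pi_pmf ?A False (\<lambda>e. return_pmf (c e \<or> c' e)) = return_pmf (\<lambda>e. if e \<in> ?A then c e \<or> c' e else False)"
        by (rule Pi_pmf_return_pmf) simp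
      ultimately show "Pi_pmf ?A False (\<lambda>e. return_pmf (c e \<or> c' e)) = return_pmf (\<lambda>e. c e \<or> c' e)"
        by simp
    qed
    finally show "Pi_pmf ?A False (\<lambda>e. bind_pmf (bernoulli_pmf q) (\<lambda>b'. return_pmf (c e \<or> b')))
      = do {c' \<leftarrow> coins n q; return_pmf (\<lambda>e. c e \<or> c' e)}" .
  qed
  finally show ?thesis .
qed

lemma card_big_clusters:
  assumes "symp R" and R: "\<And>x y. R x y \<Longrightarrow> y < n" and "k > 0"
  shows "real (card (cluster R ` big_vertices n k R)) \<le> real n / real k"
proof -
  let ?C = "cluster R ` big_vertices n k R"
  have sub: "cluster R v \<subseteq> {0..<n}" if "v \<in> big_vertices n k R" for v
    using that by (intro cluster_subset[OF R]) (auto simp: big_vertices_def)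
  then have fin: "finite X" if "X \<in> ?C" for X using that finite_subset by blast
  have ge: "k \<le> card X" if "X \<in> ?C" for X
    using that fin[OF that] by (auto simp: big_vertices_def cluster_ge_def)
  have disj: "X \<inter> Y = {}" if "X \<in> ?C" "Y \<in> ?C" "X \<noteq> Y" for X Y
  proof (rule ccontr)
    assume "X \<inter> Y \<noteq> {}"
    then obtain w where w: "w \<in> X" "w \<in> Y" by blast
    then have "cluster R w = X" "cluster R w = Y" using that cluster_eq[OF \<open>symp R\<close>] by blast+
    then show False using that by simp
  qed
  have "k * card ?C = (\<Sum>X\<in>?C. k)" by simp
  also have "\<dots> \<le> (\<Sum>X\<in>?C. card X)" using ge by (rule sum_mono)
  also have "\<dots> = card (\<Union>?C)"
    using fin disj by (intro card_Union_disjoint[symmetric]) (auto simp: pairwise_def disjnt_def)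
  also have "\<dots> \<le> card {0..<n}" using sub by (intro card_mono) auto
  finally have "k * card ?C \<le> n" by simp
  then have "real k * real (card ?C) \<le> real n" by (metis of_nat_le_iff of_nat_mult)
  then show ?thesis using \<open>k > 0\<close> by (simp add: field_simps)
qed

text \<open>Consider a smallest union of clusters that meets \<^term>\<open>X\<close> in at least \<^term>\<open>m\<close> points: by
  hypothesis it misses fewer than \<^term>\<open>m\<close> points of \<^term>\<open>X\<close>, and by minimality removing any one of
  its clusters leaves fewer than \<^term>\<open>m\<close>.\<close>

lemma split_or_giant:
  assumes sym: "symp R" and X: "finite X" "m \<le> real (card X)" and "m > 0"
    and split: "\<And>T. T \<subseteq> X \<Longrightarrow> (\<And>u. u \<in> T \<Longrightarrow> cluster R u \<inter> X \<subseteq> T) \<Longrightarrow> m \<le> real (card T) \<Longrightarrow>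
      real (card (X - T)) < m"
  shows "\<exists>v\<in>X. real (card X) - 2 * m \<le> real (card (cluster R v \<inter> X))"
proof -
  define sat where "sat T \<longleftrightarrow> T \<subseteq> X \<and> (\<forall>u\<in>T. cluster R u \<inter> X \<subseteq> T) \<and> m \<le> real (card T)" for T
  have "sat X" using X by (auto simp: sat_def)
  then obtain T where T: "sat T" and min: "\<And>T'. card T' < card T \<Longrightarrow> \<not> sat T'"
    using ex_has_least_nat[of sat X card] by (metis not_less)
  have finT: "finite T" using T X finite_subset by (auto simp: sat_def)
  have "card T > 0" using T \<open>m > 0\<close> by (auto simp: sat_def)
  then obtain v where v: "v \<in> T" by (metis card.empty equals0I less_irrefl)
  have vX: "v \<in> X" using v T by (auto simp: sat_def)
  define T' where "T' = T - cluster R v"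
  have "T' \<subset> T" using v cluster_self[of v R] unfolding T'_def by blast
  then have "card T' < card T" using finT by (rule psubset_card_mono[rotated])
  then have "\<not> sat T'" by (rule min)
  moreover have "cluster R u \<inter> X \<subseteq> T'" if "u \<in> T'" for u
  proof
    fix w assume w: "w \<in> cluster R u \<inter> X"
    then have "w \<in> T" using that T by (auto simp: sat_def T'_def)
    moreover have "w \<notin> cluster R v"
    proof
      assume "w \<in> cluster R v"
      then have "cluster R u = cluster R v" using w cluster_eq[OF sym] by blast
      then show False using that cluster_self[of u R] by (auto simp: T'_def)
    qed
    ultimately show "w \<in> T'" by (simp add: T'_def)
  qed
  moreover have "T' \<subseteq> X" using T by (auto simp: sat_def T'_def)
  ultimately have small: "real (card T') < m" by (auto simp: sat_def)
  have "real (card (X - T)) < m" using T by (intro split) (auto simp: sat_def)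
  moreover have "card X = card T + card (X - T)"
    using T X finT by (simp add: sat_def card_Diff_subset card_mono)
  moreover have "card T \<le> card T' + card (cluster R v \<inter> X)"
  proof -
    have "T \<subseteq> T' \<union> (cluster R v \<inter> X)" using T by (auto simp: sat_def T'_def)
    then have "card T \<le> card (T' \<union> (cluster R v \<inter> X))"
      using finT X by (intro card_mono) (auto simp: T'_def)
    then show ?thesis using card_Un_le order_trans by blast
  qed
  ultimately show ?thesis using small vX by (intro bexI[of _ v]) auto
qed

lemma prob_not_joined:
  fixes L :: nat
  assumes G: "finite_graph_on n G" and exp: "large_set_expander \<alpha> \<delta> d n G" and "\<alpha> > 0"
    and q: "0 \<le> q" "q \<le> 1" and "L > 0"
    and A: "A \<subseteq> {0..<n}" and B: "B \<subseteq> {0..<n}" and AB: "A \<inter> B = {}"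
    and cA: "\<delta> * real n \<le> real (card A)" and cB: "\<delta> * real n \<le> real (card B)"
  shows "measure_pmf.prob (coins n q) {c'. \<forall>u\<in>A. cluster (perc_graph G (\<lambda>e. c e \<or> c' e)) u \<inter> B = {}}
    \<le> exp (- (q ^ L * ((\<alpha> * \<delta> - d / real L) / real L) * real n))"
proof -
  obtain \<P> where \<P>: "finite \<P>" "disjoint \<P>"
    and conn: "\<And>P. P \<in> \<P> \<Longrightarrow> P \<subseteq> {0..<n} \<times> {0..<n} \<and> card P \<le> L \<and> (\<exists>u\<in>A. \<exists>w\<in>B. w \<in> cluster (perc_graph G (\<lambda>e. e \<in> P)) u)"
    and many: "real L * (\<alpha> * (\<delta> * real n) - real L * real (card \<P>)) \<le> d * real n"
    by (rule many_disjoint_connections[OF G exp \<open>\<alpha> > 0\<close> A B AB cA cB, of L]) (rule that; assumption)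
  have "{c'. \<forall>u\<in>A. cluster (perc_graph G (\<lambda>e. c e \<or> c' e)) u \<inter> B = {}} \<subseteq> {c'. \<forall>P\<in>\<P>. \<exists>e\<in>P. \<not> c' e}"
  proof (intro subsetI CollectI ballI, rule ccontr)
    fix c' P assume c': "c' \<in> {c'. \<forall>u\<in>A. cluster (perc_graph G (\<lambda>e. c e \<or> c' e)) u \<inter> B = {}}"
      and P: "P \<in> \<P>" and "\<not> (\<exists>e\<in>P. \<not> c' e)"
    then have "perc_graph G (\<lambda>e. e \<in> P) x y \<Longrightarrow> perc_graph G (\<lambda>e. c e \<or> c' e) x y" for x y
      by (auto simp: perc_graph_def)
    then have "cluster (perc_graph G (\<lambda>e. e \<in> P)) u \<subseteq> cluster (perc_graph G (\<lambda>e. c e \<or> c' e)) u" for u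
      by (rule cluster_mono)
    then show False using conn[OF P] c' by blast
  qed
  then have "measure_pmf.prob (coins n q) {c'. \<forall>u\<in>A. cluster (perc_graph G (\<lambda>e. c e \<or> c' e)) u \<inter> B = {}}
      \<le> measure_pmf.prob (coins n q) {c'. \<forall>P\<in>\<P>. \<exists>e\<in>P. \<not> c' e}"
    by (rule measure_pmf.finite_measure_mono) simp
  also have "\<dots> = (\<Prod>P\<in>\<P>. 1 - q ^ card P)"
    unfolding coins_def using \<P> conn q by (intro prob_no_set_open) auto
  also have "\<dots> \<le> (\<Prod>P\<in>\<P>. exp (- (q ^ L)))"
  proof (rule prod_mono)
    fix P assume "P \<in> \<P>"
    then have "q ^ L \<le> q ^ card P" using conn q by (intro power_decreasing) auto
    moreover have "q ^ card P \<le> 1" using q by (intro power_le_one)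
    moreover have "1 + - (q ^ L) \<le> exp (- (q ^ L))" by (rule exp_ge_add_one_self)
    ultimately show "0 \<le> 1 - q ^ card P \<and> 1 - q ^ card P \<le> exp (- (q ^ L))" by linarith
  qed
  also have "\<dots> = exp (- (q ^ L * real (card \<P>)))"
    by (simp add: mult.commute flip: exp_of_nat_mult)
  also have "\<dots> \<le> exp (- (q ^ L * ((\<alpha> * \<delta> - d / real L) / real L) * real n))"
  proof -
    have "(\<alpha> * \<delta> - d / real L) / real L * real n \<le> real (card \<P>)"
      using many \<open>L > 0\<close> by (simp add: field_simps)
    then have "q ^ L * ((\<alpha> * \<delta> - d / real L) / real L * real n) \<le> q ^ L * real (card \<P>)"
      using q by (intro mult_left_mono) auto
    then show ?thesis by (simp add: mult.assoc)
  qed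
  finally show ?thesis .
qed

lemma giant_after_sprinkling:
  fixes L k :: nat
  assumes G: "finite_graph_on n G" and exp: "large_set_expander \<alpha> \<delta> d n G" and "\<alpha> > 0"
    and q: "0 \<le> q" "q \<le> 1" and "L > 0" "k > 0" "n > 0" "\<delta> > 0"
  defines "X \<equiv> \<lambda>c. big_vertices n k (perc_graph G c)"
  shows "measure_pmf.prob (coins n q) {c'. \<not> (\<exists>v<n. real (card (X c)) - 2 * (\<delta> * real n)
        \<le> real (card (cluster (perc_graph G (\<lambda>e. c e \<or> c' e)) v)))}
    \<le> exp (real n / real k - q ^ L * ((\<alpha> * \<delta> - d / real L) / real L) * real n)" (is "?lhs \<le> _")
proof -
  let ?F = "perc_graph G c"
  let ?H = "\<lambda>c'. perc_graph G (\<lambda>e. c e \<or> c' e)"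
  let ?m = "\<delta> * real n"
  let ?x = "q ^ L * ((\<alpha> * \<delta> - d / real L) / real L) * real n"
  define \<C> where "\<C> = cluster ?F ` X c"
  have finC: "finite \<C>" by (simp add: \<C>_def X_def)
  have XV: "X c \<subseteq> {0..<n}" by (auto simp: X_def big_vertices_def)
  have symF: "symp ?F" by (rule symp_perc_graph[OF G])
  define \<I> where "\<I> = {\<D> \<in> Pow \<C>. \<Union>\<D> \<subseteq> X c \<and> ?m \<le> real (card (\<Union>\<D>)) \<and> ?m \<le> real (card (X c - \<Union>\<D>))}"
  define ev where "ev \<D> = {c'. \<forall>u\<in>\<Union>\<D>. cluster (?H c') u \<inter> (X c - \<Union>\<D>) = {}}" for \<D>
  have finI: "finite \<I>" using finC by (auto simp: \<I>_def)
  have sub: "{c'. \<not> (\<exists>v<n. real (card (X c)) - 2 * ?m \<le> real (card (cluster (?H c') v)))} \<subseteq> (\<Union>\<D>\<in>\<I>. ev \<D>)"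
  proof
    fix c' assume "c' \<in> {c'. \<not> (\<exists>v<n. real (card (X c)) - 2 * ?m \<le> real (card (cluster (?H c') v)))}"
    then have no: "real (card (cluster (?H c') v)) < real (card (X c)) - 2 * ?m" if "v < n" for v
      using that by (auto simp: not_le)
    show "c' \<in> (\<Union>\<D>\<in>\<I>. ev \<D>)"
    proof (rule ccontr)
      assume contra: "c' \<notin> (\<Union>\<D>\<in>\<I>. ev \<D>)"
      have symH: "symp (?H c')" by (rule symp_perc_graph[OF G])
      have "0 < real (card (X c)) - 2 * ?m"
        using no[of 0] \<open>n > 0\<close> by (smt (verit) of_nat_0_le_iff)
      then have "?m \<le> real (card (X c))" "?m > 0" using \<open>n > 0\<close> \<open>\<delta> > 0\<close> by (auto intro: mult_pos_pos)
      moreover have "real (card (X c - T)) < ?m"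
        if T: "T \<subseteq> X c" and closed: "\<And>u. u \<in> T \<Longrightarrow> cluster (?H c') u \<inter> X c \<subseteq> T" and mT: "?m \<le> real (card T)" for T
      proof (rule ccontr)
        assume "\<not> real (card (X c - T)) < ?m"
        define \<D> where "\<D> = cluster ?F ` T"
        have "cluster ?F u \<subseteq> T" if "u \<in> T" for u
        proof
          fix w assume w: "w \<in> cluster ?F u"
          have "u \<in> X c" using that T by blast
          then have "u < n" "cluster_ge k ?F u" by (auto simp: X_def big_vertices_def)
          moreover have "cluster ?F w = cluster ?F u" by (rule cluster_eq[OF symF w])
          moreover have "w < n"
            using cluster_subset[of ?F n u] perc_graph_bounded[OF G] \<open>u < n\<close> w by fastforce
          ultimately have "w \<in> X c" by (auto simp: X_def big_vertices_def cluster_ge_def)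
          moreover have "w \<in> cluster (?H c') u"
            using w cluster_mono[of ?F "?H c'" u] by (auto simp: perc_graph_def)
          ultimately show "w \<in> T" using closed[OF that] by blast
        qed
        then have UD: "\<Union>\<D> = T" unfolding \<D>_def using cluster_self by blast
        then have "\<D> \<in> \<I>"
          using T mT \<open>\<not> real (card (X c - T)) < ?m\<close> by (auto simp: \<I>_def \<D>_def \<C>_def)
        moreover have "c' \<in> ev \<D>" using closed by (auto simp: ev_def UD)
        ultimately show False using contra by blast
      qed
      ultimately have "\<exists>v\<in>X c. real (card (X c)) - 2 * ?m \<le> real (card (cluster (?H c') v \<inter> X c))"
        by (intro split_or_giant[OF symH]) (auto simp: X_def)
      then obtain v where v: "v \<in> X c" "real (card (X c)) - 2 * ?m \<le> real (card (cluster (?H c') v \<inter> X c))"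
        by blast
      have "v < n" using v XV by auto
      have "finite (cluster (?H c') v)"
        using cluster_subset[of "?H c'" n v] perc_graph_bounded[OF G] \<open>v < n\<close> finite_subset by blast
      then have "card (cluster (?H c') v \<inter> X c) \<le> card (cluster (?H c') v)" by (intro card_mono) auto
      then show False using v(2) no[OF \<open>v < n\<close>] by linarith
    qed
  qed
  have evx: "measure_pmf.prob (coins n q) (ev \<D>) \<le> exp (- ?x)" if "\<D> \<in> \<I>" for \<D>
    unfolding ev_def using that XV
    by (intro prob_not_joined[OF G exp \<open>\<alpha> > 0\<close> q \<open>L > 0\<close>]) (auto simp: \<I>_def)
  have "?lhs \<le> measure_pmf.prob (coins n q) (\<Union>\<D>\<in>\<I>. ev \<D>)"
    using sub by (intro measure_pmf.finite_measure_mono) auto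
  also have "\<dots> \<le> (\<Sum>\<D>\<in>\<I>. measure_pmf.prob (coins n q) (ev \<D>))"
    using finI by (intro measure_pmf.finite_measure_subadditive_finite) auto
  also have "\<dots> \<le> (\<Sum>\<D>\<in>\<I>. exp (- ?x))" by (rule sum_mono[OF evx])
  also have "\<dots> = real (card \<I>) * exp (- ?x)" by simp
  also have "\<dots> \<le> exp (real n / real k) * exp (- ?x)"
  proof (rule mult_right_mono)
    have "card \<I> \<le> card (Pow \<C>)" using finC by (intro card_mono) (auto simp: \<I>_def)
    then have "real (card \<I>) \<le> 2 ^ card \<C>" using finC by (simp add: card_Pow flip: of_nat_power)
    also have "\<dots> \<le> exp 1 ^ card \<C>"
      using exp_ge_add_one_self[of 1] by (intro power_mono) auto
    also have "\<dots> = exp (real (card \<C>))" by (simp flip: exp_of_nat_mult)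
    also have "\<dots> \<le> exp (real n / real k)"
      using card_big_clusters[OF symF, of n k] perc_graph_bounded[OF G] \<open>k > 0\<close> by (simp add: \<C>_def X_def)
    finally show "real (card \<I>) \<le> exp (real n / real k)" .
  qed simp
  also have "\<dots> = exp (real n / real k - ?x)" by (simp flip: exp_add)
  finally show ?thesis .
qed

lemma giant_exists:
  fixes L k :: nat
  assumes G: "finite_graph_on n G" and exp: "large_set_expander \<alpha> \<delta> d n G" and "\<alpha> > 0"
    and p: "0 \<le> p" "p \<le> 1" and q: "0 \<le> q" "q \<le> 1" and "L > 0" "k > 0" "n > 0" "\<delta> > 0"
  shows "measure_pmf.prob (coins n (p + (1 - p) * q)) {c. \<not> (\<exists>v<n. x - 2 * (\<delta> * real n)
        \<le> real (card (cluster (perc_graph G c) v)))}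
    \<le> measure_pmf.prob (coins n p) {c. real (card (big_vertices n k (perc_graph G c))) < x}
      + exp (real n / real k - q ^ L * ((\<alpha> * \<delta> - d / real L) / real L) * real n)"
  unfolding coins_sprinkle[OF p q]
proof (rule prob_bind_pmf_le)
  fix c assume c: "c \<notin> {c. real (card (big_vertices n k (perc_graph G c))) < x}"
  let ?C = "\<lambda>c' v. real (card (cluster (perc_graph G (\<lambda>e. c e \<or> c' e)) v))"
  have "measure_pmf.prob (do {c' \<leftarrow> coins n q; return_pmf (\<lambda>e. c e \<or> c' e)})
      {c. \<not> (\<exists>v<n. x - 2 * (\<delta> * real n) \<le> real (card (cluster (perc_graph G c) v)))}
    = measure_pmf.prob (coins n q) {c'. \<not> (\<exists>v<n. x - 2 * (\<delta> * real n) \<le> ?C c' v)}"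
    unfolding map_pmf_def[symmetric] by (simp add: vimage_def)
  also have "\<dots> \<le> measure_pmf.prob (coins n q) {c'. \<not> (\<exists>v<n. real (card (big_vertices n k (perc_graph G c)))
      - 2 * (\<delta> * real n) \<le> ?C c' v)}"
    using c by (intro measure_pmf.finite_measure_mono) (auto intro: order_trans)
  also have "\<dots> \<le> exp (real n / real k - q ^ L * ((\<alpha> * \<delta> - d / real L) / real L) * real n)"
    by (rule giant_after_sprinkling) fact+
  finally show "measure_pmf.prob (do {c' \<leftarrow> coins n q; return_pmf (\<lambda>e. c e \<or> c' e)})
      {c. \<not> (\<exists>v<n. x - 2 * (\<delta> * real n) \<le> real (card (cluster (perc_graph G c) v)))}
    \<le> exp (real n / real k - q ^ L * ((\<alpha> * \<delta> - d / real L) / real L) * real n)" .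
qed simp

section \<open>The percolated random graphs\<close>

definition percolated :: "(nat \<Rightarrow> graph pmf) \<Rightarrow> real \<Rightarrow> nat \<Rightarrow> graph pmf" where
  "percolated Gs p n = bind_pmf (Gs n) (\<lambda>G. map_pmf (perc_graph G) (coins n p))"

definition seeded :: "nat \<Rightarrow> graph \<Rightarrow> nat pmf" where
  "seeded n H = map_pmf (\<lambda>s. card (cluster H s)) (pmf_of_set {0..<n})"

lemma prob_seeded:
  assumes "n > 0"
  shows "measure_pmf.prob (seeded n H) {N. Q N} = real (card {s. s < n \<and> Q (card (cluster H s))}) / real n"
proof -
  have "{0..<n} \<inter> {s. Q (card (cluster H s))} = {s. s < n \<and> Q (card (cluster H s))}" by auto
  then show ?thesis using assms by (simp add: seeded_def vimage_def measure_pmf_of_set)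
qed

lemma percolated_prob_tendsto_0:
  assumes bad: "(\<lambda>n. measure_pmf.prob (Gs n) (Bad n)) \<longlonglongrightarrow> 0"
    and bound: "\<And>n G. n > 0 \<Longrightarrow> G \<in> set_pmf (Gs n) \<Longrightarrow> G \<notin> Bad n \<Longrightarrow>
      measure_pmf.prob (coins n p) {c. perc_graph G c \<in> E n} \<le> \<epsilon> n"
    and eps: "\<epsilon> \<longlonglongrightarrow> 0" "\<And>n. 0 \<le> \<epsilon> n"
  shows "(\<lambda>n. measure_pmf.prob (percolated Gs p n) (E n)) \<longlonglongrightarrow> 0"
proof (rule tendsto_sandwich[of "\<lambda>_. 0" _ _ "\<lambda>n. measure_pmf.prob (Gs n) (Bad n) + \<epsilon> n"])
  show "\<forall>\<^sub>F n in sequentially. measure_pmf.prob (percolated Gs p n) (E n) \<le> measure_pmf.prob (Gs n) (Bad n) + \<epsilon> n"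
    using eventually_gt_at_top[of 0]
  proof eventually_elim
    case (elim n)
    show ?case unfolding percolated_def
      using bound[OF elim] eps(2) by (intro prob_bind_pmf_le) (simp_all add: vimage_def)
  qed
  show "(\<lambda>n. measure_pmf.prob (Gs n) (Bad n) + \<epsilon> n) \<longlonglongrightarrow> 0"
    using tendsto_add[OF bad eps(1)] by simp
qed auto

context
  fixes Gs :: "nat \<Rightarrow> graph pmf" and \<mu> :: "graph measure" and p :: real
  assumes graphs: "\<And>n G. G \<in> set_pmf (Gs n) \<Longrightarrow> finite_graph_on n G"
    and mu_prob: "prob_space \<mu>" and mu_sets: "sets \<mu> = sets graph_M"
    and conv: "local_weak_conv_prob Gs \<mu>"
    and p: "0 \<le> p" "p \<le> 1"
begin

lemma bad_graphs_tendsto_0: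
  assumes exp: "(\<lambda>n. measure_pmf.prob (Gs n) {G. large_set_expander \<alpha> \<delta> d n G}) \<longlonglongrightarrow> 1" and "\<epsilon> > 0"
  shows "(\<lambda>n. measure_pmf.prob (Gs n) {G. large_set_expander \<alpha> \<delta> d n G \<longrightarrow>
      \<bar>(\<Sum>v<n. size_prob k q G v) / real n - zeta_ge \<mu> k q\<bar> > \<epsilon>}) \<longlonglongrightarrow> 0"
proof (rule tendsto_sandwich[of "\<lambda>_. 0"])
  let ?E = "\<lambda>n. {G. large_set_expander \<alpha> \<delta> d n G}"
  let ?C = "\<lambda>n. {G. \<bar>(\<Sum>v<n. size_prob k q G v) / real n - zeta_ge \<mu> k q\<bar> > \<epsilon>}"
  let ?ub = "\<lambda>n. (1 - measure_pmf.prob (Gs n) (?E n)) + measure_pmf.prob (Gs n) (?C n)"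
  show "\<forall>\<^sub>F n in sequentially. measure_pmf.prob (Gs n) {G. large_set_expander \<alpha> \<delta> d n G \<longrightarrow>
      \<bar>(\<Sum>v<n. size_prob k q G v) / real n - zeta_ge \<mu> k q\<bar> > \<epsilon>} \<le> ?ub n"
  proof (rule always_eventually, rule allI)
    fix n
    have "measure_pmf.prob (Gs n) {G. large_set_expander \<alpha> \<delta> d n G \<longrightarrow>
        \<bar>(\<Sum>v<n. size_prob k q G v) / real n - zeta_ge \<mu> k q\<bar> > \<epsilon>}
      = measure_pmf.prob (Gs n) ((space (Gs n) - ?E n) \<union> ?C n)"
      by (rule arg_cong[where f = "measure_pmf.prob (Gs n)"]) auto
    also have "\<dots> \<le> measure_pmf.prob (Gs n) (space (Gs n) - ?E n) + measure_pmf.prob (Gs n) (?C n)"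
      by (rule measure_Un_le) auto
    also have "measure_pmf.prob (Gs n) (space (Gs n) - ?E n) = 1 - measure_pmf.prob (Gs n) (?E n)"
      by (rule measure_pmf.prob_compl) simp
    finally show "measure_pmf.prob (Gs n) {G. large_set_expander \<alpha> \<delta> d n G \<longrightarrow>
        \<bar>(\<Sum>v<n. size_prob k q G v) / real n - zeta_ge \<mu> k q\<bar> > \<epsilon>} \<le> ?ub n" .
  qed
  show "?ub \<longlonglongrightarrow> 0"
    using tendsto_add[OF tendsto_diff[OF tendsto_const[of 1] exp] conv_size_prob[OF conv \<open>\<epsilon> > 0\<close>, of k q]] by simp
qed auto

lemma big_vertices_upper:
  assumes expander: "large_set_expander_seq Gs" and K: "zeta_ge \<mu> K p < z"
  shows "(\<lambda>n. measure_pmf.prob (percolated Gs p n) {H. z * real n < real (card (big_vertices n K H))}) \<longlonglongrightarrow> 0"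
proof -
  obtain d \<alpha> where "\<alpha> > 0" and exp: "\<And>\<epsilon>. 0 < \<epsilon> \<Longrightarrow> \<epsilon> < 1/2 \<Longrightarrow>
      (\<lambda>n. measure_pmf.prob (Gs n) {G. large_set_expander \<alpha> \<epsilon> d n G}) \<longlonglongrightarrow> 1"
    using expander unfolding large_set_expander_seq_def by blast
  define \<epsilon> where "\<epsilon> = (z - zeta_ge \<mu> K p) / 2"
  have "\<epsilon> > 0" using K by (simp add: \<epsilon>_def)
  let ?b = "\<lambda>n. (2 * real K)\<^sup>2 * d / \<epsilon>\<^sup>2 / real n"
  show ?thesis
  proof (rule percolated_prob_tendsto_0[where \<epsilon> = "\<lambda>n. \<bar>?b n\<bar>"])
    show "(\<lambda>n. measure_pmf.prob (Gs n) {G. large_set_expander \<alpha> (1/4) d n G \<longrightarrow>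
      \<bar>(\<Sum>v<n. size_prob K p G v) / real n - zeta_ge \<mu> K p\<bar> > \<epsilon>}) \<longlonglongrightarrow> 0"
      using exp[of "1/4"] \<open>\<epsilon> > 0\<close> by (intro bad_graphs_tendsto_0) auto
    show "(\<lambda>n. \<bar>?b n\<bar>) \<longlonglongrightarrow> 0" by (rule tendsto_rabs_zero, rule lim_const_over_n)
    fix n G
    assume "n > 0" and G: "G \<in> set_pmf (Gs n)" and good: "G \<notin> {G. large_set_expander \<alpha> (1/4) d n G \<longrightarrow>
      \<bar>(\<Sum>v<n. size_prob K p G v) / real n - zeta_ge \<mu> K p\<bar> > \<epsilon>}"
    have "measure_pmf.prob (coins n p) {c. perc_graph G c \<in> {H. z * real n < real (card (big_vertices n K H))}}
      \<le> measure_pmf.prob (coins n p)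
      {c. \<bar>real (card (big_vertices n K (perc_graph G c))) / real n - (\<Sum>v<n. size_prob K p G v) / real n\<bar> \<ge> \<epsilon>}"
    proof (rule measure_pmf.finite_measure_mono, rule subsetI)
      fix c assume "c \<in> {c. perc_graph G c \<in> {H. z * real n < real (card (big_vertices n K H))}}"
      then have "z < real (card (big_vertices n K (perc_graph G c))) / real n"
        using \<open>n > 0\<close> by (simp add: field_simps)
      moreover have "\<bar>(\<Sum>v<n. size_prob K p G v) / real n - zeta_ge \<mu> K p\<bar> \<le> \<epsilon>"
        using good by auto
      moreover have "z = zeta_ge \<mu> K p + 2 * \<epsilon>" by (simp add: \<epsilon>_def field_simps)
      ultimately show "c \<in> {c. \<bar>real (card (big_vertices n K (perc_graph G c))) / real n
          - (\<Sum>v<n. size_prob K p G v) / real n\<bar> \<ge> \<epsilon>}" by auto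
    qed simp
    also have "\<dots> \<le> ?b n"
      using graphs[OF G] good p \<open>\<epsilon> > 0\<close> \<open>n > 0\<close>
      by (intro big_vertices_concentration) (auto simp: large_set_expander_def)
    finally show "measure_pmf.prob (coins n p) {c. perc_graph G c \<in> {H. z * real n < real (card (big_vertices n K H))}}
      \<le> \<bar>?b n\<bar>" by linarith
  qed simp
qed

lemma giant_lower:
  assumes expander: "large_set_expander_seq Gs"
    and smooth: "continuous (at p within {0..1}) (zeta \<mu>)" and "\<delta> > 0"
  shows "(\<lambda>n. measure_pmf.prob (percolated Gs p n)
      {H. \<not> (\<exists>v<n. (zeta \<mu> p - \<delta>) * real n \<le> real (card (cluster H v)))}) \<longlonglongrightarrow> 0"
proof (cases "zeta \<mu> p \<le> \<delta>")
  case True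
  have "\<forall>\<^sub>F n in sequentially. measure_pmf.prob (percolated Gs p n)
      {H. \<not> (\<exists>v<n. (zeta \<mu> p - \<delta>) * real n \<le> real (card (cluster H v)))} = 0"
    using eventually_gt_at_top[of 0]
  proof eventually_elim
    case (elim n)
    have "(zeta \<mu> p - \<delta>) * real n \<le> 0" using True by (simp add: mult_nonpos_nonneg)
    then have "(zeta \<mu> p - \<delta>) * real n \<le> real (card (cluster H 0))" for H
      by (rule order_trans) simp
    then have "{H. \<not> (\<exists>v<n. (zeta \<mu> p - \<delta>) * real n \<le> real (card (cluster H v)))} = {}"
      using elim by blast
    then show ?case by simp
  qed
  then show ?thesis by (rule tendsto_eventually)
next
  case False
  have "p \<noteq> 0" using False \<open>\<delta> > 0\<close> zeta_0[OF mu_prob mu_sets] by auto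
  then have "p > 0" using p by simp
  define \<delta>1 where "\<delta>1 = \<delta> / 5"
  have "\<delta>1 > 0" using \<open>\<delta> > 0\<close> by (simp add: \<delta>1_def)
  define \<delta>2 where "\<delta>2 = min \<delta>1 (1/4)"
  have \<delta>2: "0 < \<delta>2" "\<delta>2 < 1/2" "\<delta>2 \<le> \<delta>1" using \<open>\<delta>1 > 0\<close> by (auto simp: \<delta>2_def)
  obtain d \<alpha> where "\<alpha> > 0" and exp: "\<And>\<epsilon>. 0 < \<epsilon> \<Longrightarrow> \<epsilon> < 1/2 \<Longrightarrow>
      (\<lambda>n. measure_pmf.prob (Gs n) {G. large_set_expander \<alpha> \<epsilon> d n G}) \<longlonglongrightarrow> 1"
    using expander unfolding large_set_expander_seq_def by blast
  obtain \<eta> where \<eta>: "\<eta> > 0" "\<And>x. x \<in> {0..1} \<Longrightarrow> dist x p < \<eta> \<Longrightarrow> dist (zeta \<mu> x) (zeta \<mu> p) < \<delta>1"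
    using smooth \<open>\<delta>1 > 0\<close> unfolding continuous_within_eps_delta by blast
  define p' where "p' = max 0 (p - \<eta> / 2)"
  have p': "0 \<le> p'" "p' < p" "p' < 1" "dist p' p < \<eta>"
    using \<open>p > 0\<close> p \<eta>(1) by (auto simp: p'_def dist_real_def max_def)
  then have "dist (zeta \<mu> p') (zeta \<mu> p) < \<delta>1" using \<eta>(2)[of p'] by auto
  then have zp': "zeta \<mu> p - \<delta>1 \<le> zeta \<mu> p'" by (auto simp: dist_real_def)
  define q where "q = (p - p') / (1 - p')"
  have q: "0 < q" "q \<le> 1" using p' p by (auto simp: q_def divide_simps)
  have pq: "p' + (1 - p') * q = p" using p' by (simp add: q_def)
  define L where "L = Suc (nat \<lceil>2 * \<bar>d\<bar> / (\<alpha> * \<delta>2)\<rceil>)"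
  have "L > 0" by (simp add: L_def)
  have ad: "\<alpha> * \<delta>2 > 0" using \<open>\<alpha> > 0\<close> \<delta>2 by simp
  have "2 * \<bar>d\<bar> / (\<alpha> * \<delta>2) < real L" unfolding L_def by linarith
  then have "2 * \<bar>d\<bar> < real L * (\<alpha> * \<delta>2)" using ad by (simp add: divide_simps)
  then have "d / real L < \<alpha> * \<delta>2" using \<open>L > 0\<close> ad by (simp add: divide_simps mult.commute)
  then have "(\<alpha> * \<delta>2 - d / real L) / real L > 0" using \<open>L > 0\<close> by simp
  define \<beta> where "\<beta> = q ^ L * ((\<alpha> * \<delta>2 - d / real L) / real L)"
  have "\<beta> > 0" unfolding \<beta>_def using q \<open>(\<alpha> * \<delta>2 - d / real L) / real L > 0\<close> by (intro mult_pos_pos) auto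
  define k where "k = Suc (nat \<lceil>2 / \<beta>\<rceil>)"
  have "k > 0" by (simp add: k_def)
  have "2 / \<beta> < real k" unfolding k_def by linarith
  then have k: "1 / real k \<le> \<beta> / 2" using \<open>\<beta> > 0\<close> \<open>k > 0\<close> by (simp add: divide_simps mult.commute)
  let ?b = "\<lambda>n. (2 * real k)\<^sup>2 * d / \<delta>1\<^sup>2 / real n"
  let ?e = "\<lambda>n. exp (- (\<beta> / 2) * real n)"
  show ?thesis
  proof (rule percolated_prob_tendsto_0[where \<epsilon> = "\<lambda>n. \<bar>?b n\<bar> + ?e n"])
    show "(\<lambda>n. measure_pmf.prob (Gs n) {G. large_set_expander \<alpha> \<delta>2 d n G \<longrightarrow>
      \<bar>(\<Sum>v<n. size_prob k p' G v) / real n - zeta_ge \<mu> k p'\<bar> > \<delta>1}) \<longlonglongrightarrow> 0"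
      using exp[of \<delta>2] \<delta>2 \<open>\<delta>1 > 0\<close> by (intro bad_graphs_tendsto_0) auto
    have "filterlim (\<lambda>n. - (\<beta> / 2) * real n) at_bot sequentially"
      using \<open>\<beta> > 0\<close> by (intro filterlim_tendsto_neg_mult_at_bot[OF tendsto_const _ filterlim_real_sequentially]) auto
    then have "?e \<longlonglongrightarrow> 0" by (rule filterlim_compose[OF exp_at_bot])
    moreover have "(\<lambda>n. \<bar>?b n\<bar>) \<longlonglongrightarrow> 0" by (rule tendsto_rabs_zero, rule lim_const_over_n)
    ultimately show "(\<lambda>n. \<bar>?b n\<bar> + ?e n) \<longlonglongrightarrow> 0" using tendsto_add[of _ 0 _ _ 0] by auto
    fix n G
    assume "n > 0" and G: "G \<in> set_pmf (Gs n)" and good: "G \<notin> {G. large_set_expander \<alpha> \<delta>2 d n G \<longrightarrow>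
      \<bar>(\<Sum>v<n. size_prob k p' G v) / real n - zeta_ge \<mu> k p'\<bar> > \<delta>1}"
    define x where "x = (zeta \<mu> p - 3 * \<delta>1) * real n"
    have "measure_pmf.prob (coins n p') {c. real (card (big_vertices n k (perc_graph G c))) < x}
      \<le> measure_pmf.prob (coins n p')
      {c. \<bar>real (card (big_vertices n k (perc_graph G c))) / real n - (\<Sum>v<n. size_prob k p' G v) / real n\<bar> \<ge> \<delta>1}"
    proof (rule measure_pmf.finite_measure_mono, rule subsetI)
      fix c assume "c \<in> {c. real (card (big_vertices n k (perc_graph G c))) < x}"
      then have "real (card (big_vertices n k (perc_graph G c))) / real n < zeta \<mu> p - 3 * \<delta>1"
        using \<open>n > 0\<close> by (simp add: x_def divide_simps)
      moreover have "zeta_ge \<mu> k p' - \<delta>1 \<le> (\<Sum>v<n. size_prob k p' G v) / real n"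
        using good by auto
      moreover have "zeta \<mu> p' \<le> zeta_ge \<mu> k p'" by (rule zeta_le_zeta_ge[OF mu_prob mu_sets])
      ultimately show "c \<in> {c. \<bar>real (card (big_vertices n k (perc_graph G c))) / real n
          - (\<Sum>v<n. size_prob k p' G v) / real n\<bar> \<ge> \<delta>1}" using zp' by auto
    qed simp
    also have "\<dots> \<le> ?b n"
      using graphs[OF G] good p' p \<open>\<delta>1 > 0\<close> \<open>n > 0\<close>
      by (intro big_vertices_concentration) (auto simp: large_set_expander_def)
    finally have 1: "measure_pmf.prob (coins n p') {c. real (card (big_vertices n k (perc_graph G c))) < x} \<le> ?b n" .
    have "real n / real k - \<beta> * real n \<le> - (\<beta> / 2) * real n"
      using mult_right_mono[OF k, of "real n"] by (simp add: algebra_simps)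
    then have 2: "exp (real n / real k - \<beta> * real n) \<le> ?e n" by simp
    have "measure_pmf.prob (coins n (p' + (1 - p') * q)) {c. \<not> (\<exists>v<n. x - 2 * (\<delta>2 * real n)
        \<le> real (card (cluster (perc_graph G c) v)))}
      \<le> measure_pmf.prob (coins n p') {c. real (card (big_vertices n k (perc_graph G c))) < x}
        + exp (real n / real k - q ^ L * ((\<alpha> * \<delta>2 - d / real L) / real L) * real n)"
      using graphs[OF G] good p' q \<open>\<alpha> > 0\<close> \<open>L > 0\<close> \<open>k > 0\<close> \<open>n > 0\<close> \<delta>2 by (intro giant_exists) auto
    then have 3: "measure_pmf.prob (coins n p) {c. \<not> (\<exists>v<n. x - 2 * (\<delta>2 * real n)
        \<le> real (card (cluster (perc_graph G c) v)))} \<le> \<bar>?b n\<bar> + ?e n"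
      using 1 2 unfolding pq \<beta>_def[symmetric] by linarith
    have le: "(zeta \<mu> p - \<delta>) * real n \<le> x - 2 * (\<delta>2 * real n)"
    proof -
      have "(zeta \<mu> p - \<delta>) * real n \<le> (zeta \<mu> p - 3 * \<delta>1 - 2 * \<delta>2) * real n"
        using \<delta>2(3) by (intro mult_right_mono) (auto simp: \<delta>1_def)
      then show ?thesis by (simp add: x_def algebra_simps)
    qed
    have "measure_pmf.prob (coins n p) {c. perc_graph G c \<in> {H. \<not> (\<exists>v<n. (zeta \<mu> p - \<delta>) * real n \<le> real (card (cluster H v)))}}
      \<le> measure_pmf.prob (coins n p) {c. \<not> (\<exists>v<n. x - 2 * (\<delta>2 * real n) \<le> real (card (cluster (perc_graph G c) v)))}"
      using le by (intro measure_pmf.finite_measure_mono) (auto intro: order_trans)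
    then show "measure_pmf.prob (coins n p) {c. perc_graph G c \<in> {H. \<not> (\<exists>v<n. (zeta \<mu> p - \<delta>) * real n \<le> real (card (cluster H v)))}}
      \<le> \<bar>?b n\<bar> + ?e n" using 3 by linarith
  qed simp
qed

lemma set_percolatedE:
  assumes "H \<in> set_pmf (percolated Gs p n)"
  obtains "symp H" "\<And>v. v < n \<Longrightarrow> cluster H v \<subseteq> {0..<n}"
proof -
  obtain G c where G: "finite_graph_on n G" and H: "H = perc_graph G c"
    using assms graphs by (auto simp: percolated_def)
  show thesis
  proof (rule that)
    show "symp H" unfolding H by (rule symp_perc_graph[OF G])
    show "cluster H v \<subseteq> {0..<n}" if "v < n" for v
      unfolding H using perc_graph_bounded[OF G] that by (intro cluster_subset) auto
  qed
qed

lemma sir_count_eq_percolated: "sir_count Gs p n = bind_pmf (percolated Gs p n) (seeded n)"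
proof -
  have "sir_count Gs p n = do {
     G \<leftarrow> Gs n;
     c \<leftarrow> coins n p;
     map_pmf (\<lambda>s. card (cluster (perc_graph G c) s)) (pmf_of_set {0..<n}) }"
    using graphs by (rule sir_count_eq)
  then show ?thesis by (simp add: percolated_def seeded_def bind_assoc_pmf bind_map_pmf)
qed

lemma set_sir_count:
  assumes "N \<in> set_pmf (sir_count Gs p n)" "n > 0"
  shows "N \<le> n"
proof -
  obtain H s where H: "H \<in> set_pmf (percolated Gs p n)" and s: "s < n" "N = card (cluster H s)"
    using assms by (auto simp: sir_count_eq_percolated seeded_def)
  then have "cluster H s \<subseteq> {0..<n}" using set_percolatedE[OF H] by blast
  then have "card (cluster H s) \<le> card {0..<n}" by (intro card_mono) auto
  then show ?thesis using s by simp
qed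

lemma sir_count_bounds:
  assumes expander: "large_set_expander_seq Gs"
    and smooth: "continuous (at p within {0..1}) (zeta \<mu>)" and "\<delta> > 0"
  shows "\<exists>K. \<forall>\<^sub>F n in sequentially.
    measure_pmf.prob (sir_count Gs p n) {N. K \<le> N} \<le> zeta \<mu> p + \<delta> \<and>
    measure_pmf.prob (sir_count Gs p n) {N. (zeta \<mu> p + \<delta>) * real n < real N} \<le> \<delta> \<and>
    zeta \<mu> p - \<delta> \<le> measure_pmf.prob (sir_count Gs p n) {N. (zeta \<mu> p - \<delta>) * real n \<le> real N}"
proof -
  let ?z = "zeta \<mu> p" and ?P = "sir_count Gs p" and ?R = "percolated Gs p"
  have z: "0 \<le> ?z" "?z \<le> 1" using zeta_bounds[OF mu_prob mu_sets] by auto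
  define \<delta>' where "\<delta>' = \<delta> / 2"
  have "\<delta>' > 0" using \<open>\<delta> > 0\<close> by (simp add: \<delta>'_def)
  have "\<forall>\<^sub>F K in sequentially. zeta_ge \<mu> K p < ?z + \<delta>'"
    by (rule order_tendstoD(2)[OF zeta_ge_tendsto_zeta[OF mu_prob mu_sets]]) (use \<open>\<delta>' > 0\<close> in simp)
  then obtain K where K: "zeta_ge \<mu> K p < ?z + \<delta>'" using eventually_happens'[OF sequentially_bot] by blast
  define Bad where "Bad n = {H. (?z + \<delta>') * real n < real (card (big_vertices n K H))}" for n
  define Bad' where "Bad' n = {H. \<not> (\<exists>v<n. (?z - \<delta>') * real n \<le> real (card (cluster H v)))}" for n
  have "(\<lambda>n. measure_pmf.prob (?R n) (Bad n)) \<longlonglongrightarrow> 0"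
    unfolding Bad_def by (rule big_vertices_upper[OF expander K])
  then have ev1: "\<forall>\<^sub>F n in sequentially. measure_pmf.prob (?R n) (Bad n) < \<delta>'"
    using \<open>\<delta>' > 0\<close> by (rule order_tendstoD)
  have "(\<lambda>n. measure_pmf.prob (?R n) (Bad' n)) \<longlonglongrightarrow> 0"
    unfolding Bad'_def by (rule giant_lower[OF expander smooth \<open>\<delta>' > 0\<close>])
  then have ev2: "\<forall>\<^sub>F n in sequentially. measure_pmf.prob (?R n) (Bad' n) < \<delta>'"
    using \<open>\<delta>' > 0\<close> by (rule order_tendstoD)
  have ev3: "\<forall>\<^sub>F n in sequentially. real K / \<delta> < real n"
    using filterlim_real_sequentially unfolding filterlim_at_top_dense by blast
  have "\<forall>\<^sub>F n in sequentially. measure_pmf.prob (?P n) {N. K \<le> N} \<le> ?z + \<delta> \<and>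
    measure_pmf.prob (?P n) {N. (?z + \<delta>) * real n < real N} \<le> \<delta> \<and>
    ?z - \<delta> \<le> measure_pmf.prob (?P n) {N. (?z - \<delta>) * real n \<le> real N}"
    using ev1 ev2 ev3 eventually_gt_at_top[of 0]
  proof eventually_elim
    case (elim n)
    then have "n > 0" by simp
    have "measure_pmf.prob (?P n) {N. K \<le> N} \<le> measure_pmf.prob (?R n) (Bad n) + (?z + \<delta>')"
      unfolding sir_count_eq_percolated
    proof (rule prob_bind_pmf_le)
      fix H assume "H \<notin> Bad n"
      have "card {s. s < n \<and> K \<le> card (cluster H s)} \<le> card (big_vertices n K H)"
        by (intro card_mono) (auto simp: big_vertices_def cluster_ge_def)
      then have "real (card {s. s < n \<and> K \<le> card (cluster H s)}) \<le> (?z + \<delta>') * real n"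
        using \<open>H \<notin> Bad n\<close> by (simp add: Bad_def)
      then show "measure_pmf.prob (seeded n H) {N. K \<le> N} \<le> ?z + \<delta>'"
        using \<open>n > 0\<close> by (simp add: prob_seeded divide_simps)
    qed (use z \<open>\<delta>' > 0\<close> in simp)
    then have 1: "measure_pmf.prob (?P n) {N. K \<le> N} \<le> ?z + \<delta>" using elim by (simp add: \<delta>'_def)
    have "measure_pmf.prob (?P n) {N. (?z + \<delta>) * real n < real N} \<le> measure_pmf.prob (?R n) (Bad n) + 0"
      unfolding sir_count_eq_percolated
    proof (rule prob_bind_pmf_le)
      fix H assume H: "H \<in> set_pmf (?R n)" and good: "H \<notin> Bad n"
      have "\<not> (?z + \<delta>) * real n < real (card (cluster H s))" if "s < n" for s
      proof
        assume large: "(?z + \<delta>) * real n < real (card (cluster H s))"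
        have "real K \<le> \<delta> * real n" using elim \<open>\<delta> > 0\<close> by (simp add: divide_simps mult.commute)
        also have "\<dots> \<le> (?z + \<delta>) * real n" using z by (intro mult_right_mono) auto
        finally have "K \<le> card (cluster H s)" using large by linarith
        have "cluster H s \<subseteq> big_vertices n K H"
        proof
          fix w assume w: "w \<in> cluster H s"
          have "symp H" "cluster H s \<subseteq> {0..<n}" using set_percolatedE[OF H] \<open>s < n\<close> by blast+
          then have "w < n" "cluster H w = cluster H s" using w cluster_eq[of H w s] by auto
          then show "w \<in> big_vertices n K H"
            using \<open>K \<le> card (cluster H s)\<close> by (simp add: big_vertices_def cluster_ge_def)
        qed
        then have "card (cluster H s) \<le> card (big_vertices n K H)" by (intro card_mono) auto
        moreover have "(?z + \<delta>') * real n \<le> (?z + \<delta>) * real n"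
          using \<open>\<delta> > 0\<close> by (intro mult_right_mono) (auto simp: \<delta>'_def)
        ultimately show False using good large by (simp add: Bad_def)
      qed
      then have none: "{s. s < n \<and> (?z + \<delta>) * real n < real (card (cluster H s))} = {}" by blast
      show "measure_pmf.prob (seeded n H) {N. (?z + \<delta>) * real n < real N} \<le> 0"
        unfolding prob_seeded[OF \<open>n > 0\<close>] none by simp
    qed simp
    then have 2: "measure_pmf.prob (?P n) {N. (?z + \<delta>) * real n < real N} \<le> \<delta>"
      using elim \<open>\<delta> > 0\<close> by (simp add: \<delta>'_def)
    have "measure_pmf.prob (?P n) {N. real N < (?z - \<delta>) * real n} \<le> measure_pmf.prob (?R n) (Bad' n) + (1 - (?z - \<delta>'))"
      unfolding sir_count_eq_percolated
    proof (rule prob_bind_pmf_le)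
      fix H assume H: "H \<in> set_pmf (?R n)" and "H \<notin> Bad' n"
      then obtain v where v: "v < n" "(?z - \<delta>') * real n \<le> real (card (cluster H v))" by (auto simp: Bad'_def)
      have sub: "symp H" "cluster H v \<subseteq> {0..<n}" using set_percolatedE[OF H] \<open>v < n\<close> by blast+
      have "{s. s < n \<and> real (card (cluster H s)) < (?z - \<delta>) * real n} \<subseteq> {0..<n} - cluster H v"
      proof
        fix s assume s: "s \<in> {s. s < n \<and> real (card (cluster H s)) < (?z - \<delta>) * real n}"
        have "(?z - \<delta>) * real n \<le> (?z - \<delta>') * real n"
          using \<open>\<delta> > 0\<close> by (intro mult_right_mono) (auto simp: \<delta>'_def)
        moreover have "real (card (cluster H s)) < (?z - \<delta>) * real n" using s by simp
        ultimately have "cluster H s \<noteq> cluster H v" using v(2) by force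
        then show "s \<in> {0..<n} - cluster H v" using s cluster_eq[OF sub(1), of s v] by auto
      qed
      then have "card {s. s < n \<and> real (card (cluster H s)) < (?z - \<delta>) * real n} \<le> card ({0..<n} - cluster H v)"
        by (intro card_mono) auto
      also have "\<dots> = n - card (cluster H v)"
        using sub finite_subset[OF sub(2)] by (simp add: card_Diff_subset)
      finally have "real (card {s. s < n \<and> real (card (cluster H s)) < (?z - \<delta>) * real n}) \<le> real n - real (card (cluster H v))"
        using card_mono[OF _ sub(2)] by simp
      then have "real (card {s. s < n \<and> real (card (cluster H s)) < (?z - \<delta>) * real n}) \<le> (1 - (?z - \<delta>')) * real n"
        using v(2) by (simp add: algebra_simps)
      then show "measure_pmf.prob (seeded n H) {N. real N < (?z - \<delta>) * real n} \<le> 1 - (?z - \<delta>')"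
        unfolding prob_seeded[OF \<open>n > 0\<close>] using \<open>n > 0\<close> by (simp add: divide_simps)
    qed (use z \<open>\<delta>' > 0\<close> in simp)
    moreover have "measure_pmf.prob (?P n) {N. (?z - \<delta>) * real n \<le> real N}
        = 1 - measure_pmf.prob (?P n) {N. real N < (?z - \<delta>) * real n}"
    proof -
      have "{N. (?z - \<delta>) * real n \<le> real N} = space (?P n) - {N. real N < (?z - \<delta>) * real n}" by auto
      then show ?thesis by (simp only:) (rule measure_pmf.prob_compl, simp)
    qed
    ultimately have 3: "?z - \<delta> \<le> measure_pmf.prob (?P n) {N. (?z - \<delta>) * real n \<le> real N}"
      using elim by (simp add: \<delta>'_def)
    show ?case using 1 2 3 by blast
  qed
  then show ?thesis by blast
qed

end

section \<open>From the bounds to the limit law\<close>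

context
  fixes P :: "nat \<Rightarrow> nat pmf" and z :: real
  assumes z: "0 \<le> z" "z \<le> 1"
    and support: "\<And>n N. n > 0 \<Longrightarrow> N \<in> set_pmf (P n) \<Longrightarrow> N \<le> n"
    and bounds: "\<And>\<delta>. \<delta> > 0 \<Longrightarrow> \<exists>K. \<forall>\<^sub>F n in sequentially.
      measure_pmf.prob (P n) {N. K \<le> N} \<le> z + \<delta> \<and>
      measure_pmf.prob (P n) {N. (z + \<delta>) * real n < real N} \<le> \<delta> \<and>
      z - \<delta> \<le> measure_pmf.prob (P n) {N. (z - \<delta>) * real n \<le> real N}"
begin

lemma intermediate_sizes_unlikely:
  assumes "\<delta> > 0" and small: "z > 0 \<Longrightarrow> \<delta> < z"
  shows "\<exists>K. \<forall>\<^sub>F n in sequentially.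
      measure_pmf.prob (P n) {N. K \<le> N} \<le> z + \<delta> \<and>
      measure_pmf.prob (P n) {N. (z + \<delta>) * real n < real N} \<le> \<delta> \<and>
      z - \<delta> \<le> measure_pmf.prob (P n) {N. (z - \<delta>) * real n \<le> real N} \<and>
      measure_pmf.prob (P n) {N. K \<le> N \<and> real N < (z - \<delta>) * real n} \<le> 2 * \<delta> \<and>
      (z > 0 \<longrightarrow> measure_pmf.prob (P n) {N. (z - \<delta>) * real n \<le> real N} \<le> z + \<delta>)"
proof -
  obtain K where K: "\<forall>\<^sub>F n in sequentially.
      measure_pmf.prob (P n) {N. K \<le> N} \<le> z + \<delta> \<and>
      measure_pmf.prob (P n) {N. (z + \<delta>) * real n < real N} \<le> \<delta> \<and>
      z - \<delta> \<le> measure_pmf.prob (P n) {N. (z - \<delta>) * real n \<le> real N}"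
    using bounds[OF \<open>\<delta> > 0\<close>] by blast
  have large: "\<forall>\<^sub>F n in sequentially. real K / (z - \<delta>) < real n"
    using filterlim_real_sequentially unfolding filterlim_at_top_dense by blast
  have "\<forall>\<^sub>F n in sequentially.
      measure_pmf.prob (P n) {N. K \<le> N \<and> real N < (z - \<delta>) * real n} \<le> 2 * \<delta> \<and>
      (z > 0 \<longrightarrow> measure_pmf.prob (P n) {N. (z - \<delta>) * real n \<le> real N} \<le> z + \<delta>)"
    using K large
  proof eventually_elim
    case (elim n)
    show ?case
    proof (cases "z > 0")
      case False
      then have "(z - \<delta>) * real n \<le> 0" using \<open>\<delta> > 0\<close> by (simp add: mult_nonpos_nonneg)
      then have none: "{N. K \<le> N \<and> real N < (z - \<delta>) * real n} = {}"
        using of_nat_0_le_iff order_trans not_less by blast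
      show ?thesis unfolding none using False \<open>\<delta> > 0\<close> by simp
    next
      case True
      then have "real K \<le> (z - \<delta>) * real n" using elim small by (simp add: divide_simps mult.commute)
      then have ge: "K \<le> N" if "(z - \<delta>) * real n \<le> real N" for N using that by linarith
      have "{N. K \<le> N} = {N. K \<le> N \<and> real N < (z - \<delta>) * real n} \<union> {N. (z - \<delta>) * real n \<le> real N}"
        using ge by (auto simp: not_less)
      moreover have "measure_pmf.prob (P n) ({N. K \<le> N \<and> real N < (z - \<delta>) * real n} \<union> {N. (z - \<delta>) * real n \<le> real N})
          = measure_pmf.prob (P n) {N. K \<le> N \<and> real N < (z - \<delta>) * real n} + measure_pmf.prob (P n) {N. (z - \<delta>) * real n \<le> real N}"
        by (rule measure_pmf.finite_measure_Union) auto
      ultimately have "measure_pmf.prob (P n) {N. K \<le> N}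
          = measure_pmf.prob (P n) {N. K \<le> N \<and> real N < (z - \<delta>) * real n} + measure_pmf.prob (P n) {N. (z - \<delta>) * real n \<le> real N}"
        by simp
      then show ?thesis
        using elim measure_nonneg[of "P n" "{N. K \<le> N \<and> real N < (z - \<delta>) * real n}"] by linarith
    qed
  qed
  with K have "\<forall>\<^sub>F n in sequentially.
      measure_pmf.prob (P n) {N. K \<le> N} \<le> z + \<delta> \<and>
      measure_pmf.prob (P n) {N. (z + \<delta>) * real n < real N} \<le> \<delta> \<and>
      z - \<delta> \<le> measure_pmf.prob (P n) {N. (z - \<delta>) * real n \<le> real N} \<and>
      measure_pmf.prob (P n) {N. K \<le> N \<and> real N < (z - \<delta>) * real n} \<le> 2 * \<delta> \<and>
      (z > 0 \<longrightarrow> measure_pmf.prob (P n) {N. (z - \<delta>) * real n \<le> real N} \<le> z + \<delta>)"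
    by eventually_elim blast
  then show ?thesis by blast
qed

lemma no_intermediate_sizes:
  assumes \<omega>: "filterlim \<omega> at_top sequentially"
  shows "(\<lambda>n. measure_pmf.prob (P n) {N. \<omega> n \<le> real N \<and> real N \<le> real n / \<omega> n}) \<longlonglongrightarrow> 0"
proof (rule LIMSEQ_I)
  fix r :: real assume "r > 0"
  define \<delta> where "\<delta> = (if z > 0 then min (z / 2) (r / 3) else r / 3)"
  have \<delta>: "\<delta> > 0" "z > 0 \<Longrightarrow> \<delta> < z" "2 * \<delta> < r" using \<open>r > 0\<close> by (auto simp: \<delta>_def min_def)
  obtain K where K: "\<forall>\<^sub>F n in sequentially.
      measure_pmf.prob (P n) {N. K \<le> N} \<le> z + \<delta> \<and>
      measure_pmf.prob (P n) {N. K \<le> N \<and> real N < (z - \<delta>) * real n} \<le> 2 * \<delta>"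
  proof -
    from intermediate_sizes_unlikely[OF \<delta>(1,2)] obtain K where "\<forall>\<^sub>F n in sequentially.
      measure_pmf.prob (P n) {N. K \<le> N} \<le> z + \<delta> \<and>
      measure_pmf.prob (P n) {N. (z + \<delta>) * real n < real N} \<le> \<delta> \<and>
      z - \<delta> \<le> measure_pmf.prob (P n) {N. (z - \<delta>) * real n \<le> real N} \<and>
      measure_pmf.prob (P n) {N. K \<le> N \<and> real N < (z - \<delta>) * real n} \<le> 2 * \<delta> \<and>
      (z > 0 \<longrightarrow> measure_pmf.prob (P n) {N. (z - \<delta>) * real n \<le> real N} \<le> z + \<delta>)" by blast
    then show thesis by (intro that[of K]) (rule eventually_mono, blast+)
  qed
  have "\<forall>\<^sub>F n in sequentially. max (real K) (1 / (z - \<delta>)) < \<omega> n"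
    using \<omega> unfolding filterlim_at_top_dense by blast
  with K eventually_gt_at_top[of 0]
  have "\<forall>\<^sub>F n in sequentially. norm (measure_pmf.prob (P n) {N. \<omega> n \<le> real N \<and> real N \<le> real n / \<omega> n} - 0) < r"
  proof eventually_elim
    case (elim n)
    have "measure_pmf.prob (P n) {N. \<omega> n \<le> real N \<and> real N \<le> real n / \<omega> n} \<le> 2 * \<delta>"
    proof (cases "z > 0")
      case True
      have pos: "z - \<delta> > 0" using True \<delta> by simp
      have "0 < \<omega> n" using elim by (auto intro: le_less_trans[of 0 "real K"])
      moreover have "1 < (z - \<delta>) * \<omega> n" using elim pos by (simp add: divide_simps mult.commute)
      then have "1 * real n < (z - \<delta>) * \<omega> n * real n" using elim by (intro mult_strict_right_mono) auto
      ultimately have "real n / \<omega> n < (z - \<delta>) * real n" by (simp add: divide_simps algebra_simps)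
      then have "measure_pmf.prob (P n) {N. \<omega> n \<le> real N \<and> real N \<le> real n / \<omega> n}
          \<le> measure_pmf.prob (P n) {N. K \<le> N \<and> real N < (z - \<delta>) * real n}"
        using elim by (intro measure_pmf.finite_measure_mono) auto
      then show ?thesis using elim by linarith
    next
      case False
      have "measure_pmf.prob (P n) {N. \<omega> n \<le> real N \<and> real N \<le> real n / \<omega> n} \<le> measure_pmf.prob (P n) {N. K \<le> N}"
        using elim by (intro measure_pmf.finite_measure_mono) auto
      then show ?thesis using elim False \<delta> by linarith
    qed
    then show ?case using \<delta>(3) by simp
  qed
  then show "\<exists>no. \<forall>n\<ge>no. norm (measure_pmf.prob (P n) {N. \<omega> n \<le> real N \<and> real N \<le> real n / \<omega> n} - 0) < r"
    by (simp add: eventually_sequentially)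
qed

lemma two_atom_limit:
  fixes f :: "real \<Rightarrow> real"
  assumes f: "continuous_on {0..1} f"
  shows "(\<lambda>n. measure_pmf.expectation (P n) (\<lambda>N. f (real N / real n))) \<longlonglongrightarrow> z * f z + (1 - z) * f 0"
proof (rule LIMSEQ_I)
  fix r :: real assume "r > 0"
  define \<epsilon> where "\<epsilon> = r / 10"
  have "\<epsilon> > 0" using \<open>r > 0\<close> by (simp add: \<epsilon>_def)
  have "bounded (f ` {0..1})" using f by (intro compact_imp_bounded compact_continuous_image) auto
  then obtain B where "B > 0" and B: "\<And>x. x \<in> {0..1} \<Longrightarrow> \<bar>f x\<bar> \<le> B"
    unfolding bounded_pos by auto
  have "uniformly_continuous_on {0..1} f" using f by (intro compact_uniformly_continuous) auto
  then obtain \<delta>0 where "\<delta>0 > 0" and cont: "\<And>x y. x \<in> {0..1} \<Longrightarrow> y \<in> {0..1} \<Longrightarrow> \<bar>x - y\<bar> < \<delta>0 \<Longrightarrow> \<bar>f x - f y\<bar> < \<epsilon>"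
    using \<open>\<epsilon> > 0\<close> unfolding uniformly_continuous_on_def dist_real_def by metis
  define \<delta> where "\<delta> = min (if z > 0 then z / 2 else 1) (min (\<delta>0 / 2) (\<epsilon> / B))"
  have \<delta>: "\<delta> > 0" "z > 0 \<Longrightarrow> \<delta> < z" "\<delta> < \<delta>0" "B * \<delta> \<le> \<epsilon>"
  proof -
    show "\<delta> > 0" using \<open>\<epsilon> > 0\<close> \<open>B > 0\<close> \<open>\<delta>0 > 0\<close> by (auto simp: \<delta>_def)
    show "z > 0 \<Longrightarrow> \<delta> < z" "\<delta> < \<delta>0" using \<open>\<delta>0 > 0\<close> by (auto simp: \<delta>_def)
    have "\<delta> \<le> \<epsilon> / B" by (simp add: \<delta>_def)
    then show "B * \<delta> \<le> \<epsilon>" using \<open>B > 0\<close> by (simp add: divide_simps mult.commute)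
  qed
  obtain K where K: "\<forall>\<^sub>F n in sequentially.
      measure_pmf.prob (P n) {N. K \<le> N} \<le> z + \<delta> \<and>
      measure_pmf.prob (P n) {N. (z + \<delta>) * real n < real N} \<le> \<delta> \<and>
      z - \<delta> \<le> measure_pmf.prob (P n) {N. (z - \<delta>) * real n \<le> real N} \<and>
      measure_pmf.prob (P n) {N. K \<le> N \<and> real N < (z - \<delta>) * real n} \<le> 2 * \<delta> \<and>
      (z > 0 \<longrightarrow> measure_pmf.prob (P n) {N. (z - \<delta>) * real n \<le> real N} \<le> z + \<delta>)"
    using intermediate_sizes_unlikely[OF \<delta>(1,2)] by blast
  have "\<forall>\<^sub>F n in sequentially. real K / \<delta>0 < real n"
    using filterlim_real_sequentially unfolding filterlim_at_top_dense by blast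
  with K eventually_gt_at_top[of 0]
  have "\<forall>\<^sub>F n in sequentially. norm (measure_pmf.expectation (P n) (\<lambda>N. f (real N / real n)) - (z * f z + (1 - z) * f 0)) < r"
  proof eventually_elim
    case (elim n)
    then have n: "n > 0" by simp
    have Kn: "real K < \<delta>0 * real n" using elim \<open>\<delta>0 > 0\<close> by (simp add: divide_simps mult.commute)
    have fin: "finite (set_pmf (P n))"
      by (rule finite_subset[of _ "{..n}"]) (use support[OF n] in auto)
    have int: "integrable (measure_pmf (P n)) f" for f :: "_ \<Rightarrow> real"
      by (rule integrable_measure_pmf_finite[OF fin])
    define mid where "mid = {N. K \<le> N \<and> real N < (z - \<delta>) * real n}"
    define top where "top = {N. (z + \<delta>) * real n < real N}"
    define up where "up = {N. (z - \<delta>) * real n \<le> real N}"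
    define g where "g N = f 0 + (f z - f 0) * indicator up N" for N
    have "\<bar>f (real N / real n) - g N\<bar> \<le> \<epsilon> + 2 * B * (indicator mid N + indicator top N)"
      if N: "N \<in> set_pmf (P n)" for N
    proof -
      have x: "real N / real n \<in> {0..1}" using support[OF n N] n by (auto simp: divide_simps)
      have gB: "\<bar>g N\<bar> \<le> B" using B[of z] B[of 0] z by (auto simp: g_def indicator_def)
      show ?thesis
      proof (cases "N \<in> mid \<or> N \<in> top")
        case True
        have "\<bar>f (real N / real n) - g N\<bar> \<le> 2 * B" using B[OF x] gB by linarith
        moreover have "2 * B * 1 \<le> 2 * B * (indicator mid N + indicator top N)"
          using True \<open>B > 0\<close> by (intro mult_left_mono) (auto simp: indicator_def)
        ultimately show ?thesis using \<open>\<epsilon> > 0\<close> by linarith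
      next
        case False
        have "\<bar>f (real N / real n) - g N\<bar> < \<epsilon>"
        proof (cases "N \<in> up")
          case True
          then have "z - \<delta> \<le> real N / real n" "real N / real n \<le> z + \<delta>"
            using False n by (auto simp: up_def top_def divide_simps)
          then have "\<bar>real N / real n - z\<bar> < \<delta>0" using \<delta>(3) by linarith
          then show ?thesis using cont[OF x, of z] z True by (simp add: g_def)
        next
          case False': False
          then have "N < K" using False by (auto simp: up_def mid_def not_le)
          then have "real N < \<delta>0 * real n" using Kn by linarith
          then have "\<bar>real N / real n - 0\<bar> < \<delta>0" using n by (simp add: divide_simps)
          then show ?thesis using cont[OF x, of 0] False' by (simp add: g_def)
        qed
        then show ?thesis using False by simp
      qed
    qed
    then have "measure_pmf.expectation (P n) (\<lambda>N. \<bar>f (real N / real n) - g N\<bar>)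
        \<le> measure_pmf.expectation (P n) (\<lambda>N. \<epsilon> + 2 * B * (indicator mid N + indicator top N))"
      using int by (intro integral_mono_AE AE_pmfI) auto
    also have "\<dots> = \<epsilon> + 2 * B * (measure_pmf.prob (P n) mid + measure_pmf.prob (P n) top)"
      using int by simp
    also have "\<dots> \<le> \<epsilon> + 2 * B * (3 * \<delta>)"
      using elim \<open>B > 0\<close> by (intro add_left_mono mult_left_mono) (auto simp: mid_def top_def)
    finally have A: "measure_pmf.expectation (P n) (\<lambda>N. \<bar>f (real N / real n) - g N\<bar>) \<le> 7 * \<epsilon>"
      using \<delta>(4) by simp
    have "\<bar>measure_pmf.expectation (P n) (\<lambda>N. f (real N / real n)) - measure_pmf.expectation (P n) g\<bar>
        = \<bar>measure_pmf.expectation (P n) (\<lambda>N. f (real N / real n) - g N)\<bar>"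
      using int by simp
    also have "\<dots> \<le> 7 * \<epsilon>" by (rule order_trans[OF integral_abs_bound A])
    finally have 1: "\<bar>measure_pmf.expectation (P n) (\<lambda>N. f (real N / real n)) - measure_pmf.expectation (P n) g\<bar> \<le> 7 * \<epsilon>" .
    define u where "u = measure_pmf.prob (P n) up"
    have "measure_pmf.expectation (P n) g = f 0 + (f z - f 0) * u"
      unfolding g_def u_def using int by simp
    then have "measure_pmf.expectation (P n) g - (z * f z + (1 - z) * f 0) = (f z - f 0) * (u - z)"
      by (simp add: algebra_simps)
    moreover have "\<bar>(f z - f 0) * (u - z)\<bar> \<le> 2 * \<epsilon>"
    proof (cases "z > 0")
      case True
      then have "\<bar>u - z\<bar> \<le> \<delta>" using elim by (auto simp: u_def up_def)
      moreover have "\<bar>f z - f 0\<bar> \<le> 2 * B" using B[of z] B[of 0] z by auto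
      ultimately have "\<bar>(f z - f 0) * (u - z)\<bar> \<le> 2 * B * \<delta>"
        unfolding abs_mult by (intro mult_mono) auto
      then show ?thesis using \<delta>(4) by simp
    next
      case False
      then show ?thesis using z \<open>\<epsilon> > 0\<close> by simp
    qed
    ultimately have "\<bar>measure_pmf.expectation (P n) (\<lambda>N. f (real N / real n)) - (z * f z + (1 - z) * f 0)\<bar> \<le> 9 * \<epsilon>"
      using 1 by linarith
    then show ?case using \<open>r > 0\<close> by (simp add: \<epsilon>_def)
  qed
  then show "\<exists>no. \<forall>n\<ge>no. norm (measure_pmf.expectation (P n) (\<lambda>N. f (real N / real n)) - (z * f z + (1 - z) * f 0)) < r"
    by (simp add: eventually_sequentially)
qed

end

theorem theorem1p1:
  fixes Gs :: "nat \<Rightarrow> graph pmf" and \<mu> :: "graph measure" and p :: real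
  assumes graphs: "\<And>n G. G \<in> set_pmf (Gs n) \<Longrightarrow> finite_graph_on n G"
    and expander: "large_set_expander_seq Gs"
    and mu_prob: "prob_space \<mu>" and mu_sets: "sets \<mu> = sets graph_M"
    and mu_graphs: "AE G in \<mu>. simple_graph G \<and> locally_finite G"
    and conv: "local_weak_conv_prob Gs \<mu>"
    and p: "0 \<le> p" "p \<le> 1"
    and smooth: "continuous (at p within {0..1}) (zeta \<mu>)"
  shows "(\<forall>\<omega> :: nat \<Rightarrow> real. filterlim \<omega> at_top sequentially \<and>
            (\<lambda>n. \<omega> n / real n) \<longlonglongrightarrow> 0 \<longrightarrow>
            (\<lambda>n. measure_pmf.prob (sir_count Gs p n)
               {N. \<omega> n \<le> real N \<and> real N \<le> real n / \<omega> n}) \<longlonglongrightarrow> 0)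
       \<and> (\<forall>f :: real \<Rightarrow> real. continuous_on {0..1} f \<longrightarrow>
            (\<lambda>n. measure_pmf.expectation (sir_count Gs p n) (\<lambda>N. f (real N / real n)))
              \<longlonglongrightarrow> zeta \<mu> p * f (zeta \<mu> p) + (1 - zeta \<mu> p) * f 0)"
proof (intro conjI allI impI)
  have z: "0 \<le> zeta \<mu> p" "zeta \<mu> p \<le> 1" using zeta_bounds[OF mu_prob mu_sets] by auto
  have support: "N \<le> n" if "n > 0" "N \<in> set_pmf (sir_count Gs p n)" for n N
    using that by (intro set_sir_count[OF graphs mu_prob mu_sets conv p])
  note bounds = sir_count_bounds[OF graphs mu_prob mu_sets conv p expander smooth]
  show "(\<lambda>n. measure_pmf.prob (sir_count Gs p n) {N. \<omega> n \<le> real N \<and> real N \<le> real n / \<omega> n}) \<longlonglongrightarrow> 0"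
    if "filterlim \<omega> at_top sequentially \<and> (\<lambda>n. \<omega> n / real n) \<longlonglongrightarrow> 0" for \<omega> :: "nat \<Rightarrow> real"
    using that by (intro no_intermediate_sizes[OF z support bounds]) auto
  show "(\<lambda>n. measure_pmf.expectation (sir_count Gs p n) (\<lambda>N. f (real N / real n)))
      \<longlonglongrightarrow> zeta \<mu> p * f (zeta \<mu> p) + (1 - zeta \<mu> p) * f 0" if "continuous_on {0..1} f" for f :: "real \<Rightarrow> real"
    using that by (intro two_atom_limit[OF z support bounds]) auto
qed

end
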